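(* Let $W$ be the $\mathrm{mcG}(q)$, $\mathrm{mdG}(q)$, $\mathrm{mcG}(q)^*$, or $\mathrm{mdG}(q)^*$ solution of the linear problem $\dot w(t)+B(t)w(t)=0$, $t\in(0,T]$, $w(0)=w_0$. Then there is a constant $C=C(q)$, depending only on the highest order $\max q_{ij}$, such that if $K_nC\|B\|_{L_\infty([T_{n-1},T_n],l_p)}\le1$ for $n=1,\dots,M$, then $$\|W\|_{L_\infty([T_{n-1},T_n],l_p)}\le C\|w_0\|_{l_p}\exp\Big(\sum_{m=1}^{n-1}K_mC\|B\|_{L_\infty([T_{m-1},T_m],l_p)}\Big)$$ for $n=1,\dots,M$, $1\le p\le\infty$.
   Context: For each component $i=1,\dots,N$, $(0,T]$ is partitioned into subintervals $I_{ij}=(t_{i,j-1},t_{ij}]$, $j=1,\dots,M_i$, each with a polynomial degree $q_{ij}$. $0=T_0<T_1<\dots<T_M=T$ are synchronized time levels (nodes common to all components), $K_n=T_n-T_{n-1}$. $\mathcal P^q(I)$: polynomials of degree (at most) $q$ on $I$; $(\cdot,\cdot)$: inner product of $\mathbb R^N$; $[v]_t=v(t^+)-v(t^-)$, $[v_i]_{ij}=[v_i]_{t_{ij}}$. $\|v\|_{L_\infty(I,l_p)}=\sup_{t\in I}\|v(t)\|_{l_p}$ (for the matrix function $B:[0,T]\to\mathbb R^{N\times N}$, the induced $l_p$ operator norm). $w_0\in\mathbb R^N$. $\mathrm{mcG}(q)$ ($q_{ij}\ge1$): $V$ = continuous $v$ with $v_i|_{I_{ij}}\in\mathcal P^{q_{ij}}(I_{ij})$,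 $\hat V$ = possibly discontinuous $v$ with $v_i|_{I_{ij}}\in\mathcal P^{q_{ij}-1}(I_{ij})$; $W\in V$, $W(0)=w_0$, $\int_0^T(\dot W,v)\,dt=-\int_0^T(BW,v)\,dt$ for all $v\in\hat V$. $\mathrm{mdG}(q)$ ($q_{ij}\ge0$): $V=\hat V$ = possibly discontinuous $v$ with $v_i|_{I_{ij}}\in\mathcal P^{q_{ij}}(I_{ij})$; $W\in V$, $W(0^-)=w_0$, $\sum_{i,j}\big[[W_i]_{i,j-1}v_i(t_{i,j-1}^+)+\int_{I_{ij}}\dot W_iv_i\,dt\big]=-\int_0^T(BW,v)\,dt$ for all $v\in\hat V$. Dual methods: the linear problem is the time reversal $w(t)=\phi(T-t)$ of the dual problem $-\dot\phi+A^\top(t)\phi=0$ on $[0,T)$, $\phi(T)=\psi$, with $w_0=\psi$ and $B(t)=A^\top(T-t)$; correspondingly $W(t)=\Phi(T-t)$ (the partition being reflected in time, so that $I_{ij}$, $T_n$ above refer to the variable of $W$), where $\Phi$ is the dual discrete solution on the partition in the original time variable: $\mathrm{mcG}(q)^*$: $\Phi\in\hat V$ ($V,\hat V$ as for $\mathrm{mcG}(q)$), $\Phi(T^+)=\psi$, $\int_0^T(\dot v,\Phi)\,dt=-\int_0^T(Av,\Phi)\,dt+(v(T),\psi)$ for all $v\in V$ with $v(0)=0$. $\mathrm{mdG}(q)^*$: $\Phi\in\hat V$ ($V=\hat V$ as for $\mathrm{mdG}(q)$), $\Phi(T^+)=\psi$, $\sum_{i,j}\big[[v_i]_{i,j-1}\Phi_i(t_{i,j-1}^+)+\int_{I_{ij}}\dot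 v_i\Phi_i\,dt\big]=-\int_0^T(Av,\Phi)\,dt+(v(T),\psi)$ for all $v\in V$ with $v(0^-)=0$. *)

theory Defs
  imports "HOL-Analysis.Analysis" "HOL-Computational_Algebra.Polynomial"
begin

text \<open>
  The number of components \<open>N\<close> must not influence the stability constant, so it cannot be a
  type: vectors of \<open>\<real>\<^sup>N\<close> are functions \<^typ>\<open>nat \<Rightarrow> real\<close> and matrices functions
  \<^typ>\<open>nat \<Rightarrow> nat \<Rightarrow> real\<close> (row index first), of which only the entries with indices below
  \<open>N\<close> are relevant.
\<close>

definition ip :: "nat \<Rightarrow> (nat \<Rightarrow> real) \<Rightarrow> (nat \<Rightarrow> real) \<Rightarrow> real" where
  "ip N x y = (\<Sum>i<N. x i * y i)"

definition mat_vec :: "nat \<Rightarrow> (nat \<Rightarrow> nat \<Rightarrow> real) \<Rightarrow> (nat \<Rightarrow> real) \<Rightarrow> nat \<Rightarrow> real" where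
  "mat_vec N A x i = (\<Sum>j<N. A i j * x j)"

definition lp_norm :: "nat \<Rightarrow> ereal \<Rightarrow> (nat \<Rightarrow> real) \<Rightarrow> real" where
  "lp_norm N p x =
     (if p = \<infinity> then Max ((\<lambda>i. \<bar>x i\<bar>) ` {..<N})
      else (\<Sum>i<N. \<bar>x i\<bar> powr real_of_ereal p) powr (1 / real_of_ereal p))"

definition lp_opnorm :: "nat \<Rightarrow> ereal \<Rightarrow> (nat \<Rightarrow> nat \<Rightarrow> real) \<Rightarrow> real" where
  "lp_opnorm N p A =
     (SUP x\<in>{x. lp_norm N p x \<noteq> 0}. lp_norm N p (mat_vec N A x) / lp_norm N p x)"

text \<open>
  Real-valued suprema, to be used only for functions that are bounded on \<open>[a, b]\<close>.
\<close>

definition Linf_vec :: "nat \<Rightarrow> ereal \<Rightarrow> real \<Rightarrow> real \<Rightarrow> (real \<Rightarrow> nat \<Rightarrow> real) \<Rightarrow> real" where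
  "Linf_vec N p a b v = (SUP s\<in>{a..b}. lp_norm N p (v s))"

definition Linf_mat :: "nat \<Rightarrow> ereal \<Rightarrow> real \<Rightarrow> real \<Rightarrow> (real \<Rightarrow> nat \<Rightarrow> nat \<Rightarrow> real) \<Rightarrow> real" where
  "Linf_mat N p a b B = (SUP s\<in>{a..b}. lp_opnorm N p (B s))"

text \<open>
  A multi-adaptive partition: component \<open>i < ncomp\<close> has the \<open>npieces i\<close> intervals
  \<open>(node i (j - 1), node i j]\<close>, \<open>1 \<le> j \<le> npieces i\<close>, with degrees \<open>qdeg i j\<close>.
\<close>

record partition =
  ncomp :: nat
  horizon :: real
  npieces :: "nat \<Rightarrow> nat"
  node :: "nat \<Rightarrow> nat \<Rightarrow> real"
  qdeg :: "nat \<Rightarrow> nat \<Rightarrow> nat"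

definition valid_partition :: "partition \<Rightarrow> bool" where
  "valid_partition P \<longleftrightarrow>
     1 \<le> ncomp P \<and> 0 < horizon P \<and>
     (\<forall>i<ncomp P. 1 \<le> npieces P i \<and> node P i 0 = 0 \<and> node P i (npieces P i) = horizon P \<and>
        (\<forall>j\<in>{1..npieces P i}. node P i (j - 1) < node P i j))"

definition max_order :: "partition \<Rightarrow> nat" where
  "max_order P = Max (\<Union>i<ncomp P. qdeg P i ` {1..npieces P i})"

definition reflect :: "partition \<Rightarrow> partition" where
  "reflect P = P
     \<lparr>node := \<lambda>i j. horizon P - node P i (npieces P i - j),
      qdeg := \<lambda>i j. qdeg P i (npieces P i + 1 - j)\<rparr>"

definition synchronized_levels :: "partition \<Rightarrow> nat \<Rightarrow> (nat \<Rightarrow> real) \<Rightarrow> bool" where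
  "synchronized_levels P M \<tau> \<longleftrightarrow>
     \<tau> 0 = 0 \<and> \<tau> M = horizon P \<and> (\<forall>n\<in>{1..M}. \<tau> (n - 1) < \<tau> n) \<and>
     (\<forall>n\<le>M. \<forall>i<ncomp P. \<tau> n \<in> node P i ` {0..npieces P i})"

definition right_lim :: "(real \<Rightarrow> real) \<Rightarrow> real \<Rightarrow> real" where
  "right_lim f s = Lim (at_right s) f"

definition left_lim :: "(real \<Rightarrow> real) \<Rightarrow> real \<Rightarrow> real" where
  "left_lim f s = Lim (at_left s) f"

definition jump :: "(real \<Rightarrow> real) \<Rightarrow> real \<Rightarrow> real" where
  "jump f s = right_lim f s - left_lim f s"

text \<open>
  Piecewise polynomials on the left-open intervals of the partition. The intervals do not cover
  the time \<open>0\<close>; as suprema are taken over closed time slabs, the value there is fixed to be the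
  right-hand limit. Values outside \<open>[0, horizon P]\<close> are free; they enter only through the
  limits \<open>v(0\<^sup>-)\<close> and \<open>v(T\<^sup>+)\<close>, which the methods below prescribe.
\<close>

definition broken_space :: "partition \<Rightarrow> (nat \<Rightarrow> nat \<Rightarrow> nat) \<Rightarrow> (real \<Rightarrow> nat \<Rightarrow> real) set" where
  "broken_space P d =
     {v. \<forall>i<ncomp P. ((\<lambda>s. v s i) \<longlongrightarrow> v 0 i) (at_right 0) \<and>
        (\<forall>j\<in>{1..npieces P i}. \<exists>f :: real poly. degree f \<le> d i j \<and>
           (\<forall>s\<in>{node P i (j - 1)<..node P i j}. v s i = poly f s))}"

definition mcG_V :: "partition \<Rightarrow> (real \<Rightarrow> nat \<Rightarrow> real) set" where
  "mcG_V P =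
     {v \<in> broken_space P (qdeg P). \<forall>i<ncomp P. continuous_on {0..horizon P} (\<lambda>s. v s i)}"

definition mcG_Vhat :: "partition \<Rightarrow> (real \<Rightarrow> nat \<Rightarrow> real) set" where
  "mcG_Vhat P = broken_space P (\<lambda>i j. qdeg P i j - 1)"

definition mdG_V :: "partition \<Rightarrow> (real \<Rightarrow> nat \<Rightarrow> real) set" where
  "mdG_V P = broken_space P (qdeg P)"

definition mcG_orders :: "partition \<Rightarrow> bool" where
  "mcG_orders P \<longleftrightarrow> (\<forall>i<ncomp P. \<forall>j\<in>{1..npieces P i}. 1 \<le> qdeg P i j)"

text \<open>
  \<open>dt v\<close> is the componentwise derivative; its values at the finitely many nodes, where it need
  not exist, do not affect the integrals.
\<close>

definition dt :: "(real \<Rightarrow> nat \<Rightarrow> real) \<Rightarrow> real \<Rightarrow> nat \<Rightarrow> real" where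
  "dt v s i = deriv (\<lambda>r. v r i) s"

definition mdG_form ::
  "partition \<Rightarrow> (real \<Rightarrow> nat \<Rightarrow> real) \<Rightarrow> (real \<Rightarrow> nat \<Rightarrow> real) \<Rightarrow> real" where
  "mdG_form P u v =
     (\<Sum>i<ncomp P. \<Sum>j=1..npieces P i.
        jump (\<lambda>s. u s i) (node P i (j - 1)) * right_lim (\<lambda>s. v s i) (node P i (j - 1)) +
        integral {node P i (j - 1)..node P i j} (\<lambda>s. dt u s i * v s i))"

definition mcG_solution ::
  "partition \<Rightarrow> (real \<Rightarrow> nat \<Rightarrow> nat \<Rightarrow> real) \<Rightarrow> (nat \<Rightarrow> real) \<Rightarrow> (real \<Rightarrow> nat \<Rightarrow> real) \<Rightarrow> bool" where
  "mcG_solution P B w0 W \<longleftrightarrow>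
     mcG_orders P \<and> W \<in> mcG_V P \<and> (\<forall>i<ncomp P. W 0 i = w0 i) \<and>
     (\<forall>v\<in>mcG_Vhat P.
        integral {0..horizon P} (\<lambda>s. ip (ncomp P) (dt W s) (v s)) =
        - integral {0..horizon P} (\<lambda>s. ip (ncomp P) (mat_vec (ncomp P) (B s) (W s)) (v s)))"

definition mdG_solution ::
  "partition \<Rightarrow> (real \<Rightarrow> nat \<Rightarrow> nat \<Rightarrow> real) \<Rightarrow> (nat \<Rightarrow> real) \<Rightarrow> (real \<Rightarrow> nat \<Rightarrow> real) \<Rightarrow> bool" where
  "mdG_solution P B w0 W \<longleftrightarrow>
     W \<in> mdG_V P \<and> (\<forall>i<ncomp P. ((\<lambda>s. W s i) \<longlongrightarrow> w0 i) (at_left 0)) \<and>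
     (\<forall>v\<in>mdG_V P.
        mdG_form P W v =
        - integral {0..horizon P} (\<lambda>s. ip (ncomp P) (mat_vec (ncomp P) (B s) (W s)) (v s)))"

definition mcG_dual_solution ::
  "partition \<Rightarrow> (real \<Rightarrow> nat \<Rightarrow> nat \<Rightarrow> real) \<Rightarrow> (nat \<Rightarrow> real) \<Rightarrow> (real \<Rightarrow> nat \<Rightarrow> real) \<Rightarrow> bool" where
  "mcG_dual_solution P A \<psi> \<Phi> \<longleftrightarrow>
     mcG_orders P \<and> \<Phi> \<in> mcG_Vhat P \<and>
     (\<forall>i<ncomp P. ((\<lambda>s. \<Phi> s i) \<longlongrightarrow> \<psi> i) (at_right (horizon P))) \<and>
     (\<forall>v\<in>mcG_V P. (\<forall>i<ncomp P. v 0 i = 0) \<longrightarrow>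
        integral {0..horizon P} (\<lambda>s. ip (ncomp P) (dt v s) (\<Phi> s)) =
        - integral {0..horizon P} (\<lambda>s. ip (ncomp P) (mat_vec (ncomp P) (A s) (v s)) (\<Phi> s))
        + ip (ncomp P) (v (horizon P)) \<psi>)"

definition mdG_dual_solution ::
  "partition \<Rightarrow> (real \<Rightarrow> nat \<Rightarrow> nat \<Rightarrow> real) \<Rightarrow> (nat \<Rightarrow> real) \<Rightarrow> (real \<Rightarrow> nat \<Rightarrow> real) \<Rightarrow> bool" where
  "mdG_dual_solution P A \<psi> \<Phi> \<longleftrightarrow>
     \<Phi> \<in> mdG_V P \<and>
     (\<forall>i<ncomp P. ((\<lambda>s. \<Phi> s i) \<longlongrightarrow> \<psi> i) (at_right (horizon P))) \<and>
     (\<forall>v\<in>mdG_V P. (\<forall>i<ncomp P. ((\<lambda>s. v s i) \<longlongrightarrow> 0) (at_left 0)) \<longrightarrow>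
        mdG_form P v \<Phi> =
        - integral {0..horizon P} (\<lambda>s. ip (ncomp P) (mat_vec (ncomp P) (A s) (v s)) (\<Phi> s))
        + ip (ncomp P) (v (horizon P)) \<psi>)"

text \<open>
  The dual methods in the reversed time variable of \<open>W\<close>: \<open>P\<close>, \<open>B\<close>, \<open>W\<close> refer to that
  variable, so \<open>\<Phi>\<close> lives on the reflected partition.
\<close>

definition mcG_star_solution ::
  "partition \<Rightarrow> (real \<Rightarrow> nat \<Rightarrow> nat \<Rightarrow> real) \<Rightarrow> (nat \<Rightarrow> real) \<Rightarrow> (real \<Rightarrow> nat \<Rightarrow> real) \<Rightarrow> bool" where
  "mcG_star_solution P B w0 W \<longleftrightarrow>
     (\<exists>A \<psi> \<Phi>. mcG_dual_solution (reflect P) A \<psi> \<Phi> \<and> w0 = \<psi> \<and>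
        (\<forall>s i j. B s i j = A (horizon P - s) j i) \<and> (\<forall>s. W s = \<Phi> (horizon P - s)))"

definition mdG_star_solution ::
  "partition \<Rightarrow> (real \<Rightarrow> nat \<Rightarrow> nat \<Rightarrow> real) \<Rightarrow> (nat \<Rightarrow> real) \<Rightarrow> (real \<Rightarrow> nat \<Rightarrow> real) \<Rightarrow> bool" where
  "mdG_star_solution P B w0 W \<longleftrightarrow>
     (\<exists>A \<psi> \<Phi>. mdG_dual_solution (reflect P) A \<psi> \<Phi> \<and> w0 = \<psi> \<and>
        (\<forall>s i j. B s i j = A (horizon P - s) j i) \<and> (\<forall>s. W s = \<Phi> (horizon P - s)))"

text \<open>
  The least regularity for which the integrals and the sup norms of \<open>B\<close> are meaningful.
\<close>

definition bounded_measurable_matrix ::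
  "nat \<Rightarrow> real \<Rightarrow> (real \<Rightarrow> nat \<Rightarrow> nat \<Rightarrow> real) \<Rightarrow> bool" where
  "bounded_measurable_matrix N T B \<longleftrightarrow>
     (\<forall>i<N. \<forall>j<N. (\<lambda>s. B s i j) \<in> borel_measurable (lebesgue_on {0..T}) \<and>
        bounded ((\<lambda>s. B s i j) ` {0..T}))"

end

theory Submission
  imports Defs
begin

text \<open>
  Put \<open>r = B W\<close> and \<open>F t = w0 - \<integral>\<^sub>0\<^sup>t r\<close>, so that an exact solution satisfies \<open>w = F\<close>. Each of the
  four methods, tested with functions supported on one interval \<open>I = [a, b]\<close> of one component \<open>i\<close>
  (for mcG*, whose test functions are continuous, with functions constant on both sides of \<open>I\<close>),
  says that \<open>W\<^sub>i\<close> on \<open>I\<close> is a projection of \<open>F\<^sub>i\<close>, and therefore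
  
    \<open>\<bar>W\<^sub>i t - F\<^sub>i a\<bar> \<le> D \<integral>\<^sub>I \<bar>r\<^sub>i\<bar>\<close> for \<open>t \<in> I\<close>,
  
  with \<open>D\<close> depending only on the highest degree. The choice of the test function makes this an
  energy estimate: \<open>W'\<close> for mcG, \<open>(t - a) W'\<close> for mdG and, in the time direction of \<open>\<Phi>\<close>,
  \<open>(t - b) \<Phi>'\<close> for mdG* and an antiderivative of \<open>\<Phi> - F(b)\<close> for mcG*. Up to powers of
  \<open>b - a\<close>, all four energies dominate \<open>\<integral>\<^sub>I (t - a) (b - t) g\<^sup>2\<close> for a polynomial \<open>g\<close> (a derivative for the
  first three, \<open>\<Phi> - F(b)\<close> for the last), and that quantity dominates \<open>(b - a)\<^sup>3 max \<bar>g\<bar>\<^sup>2\<close> by the inverse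
  inequality \<open>weighted_inverse_inequality\<close>. The outcome is \<open>local_bound\<close>, proved in
  \<open>mcG_local_bound\<close>, \<open>mdG_local_bound\<close> and \<open>star_local_bound\<close>.
  
  As every component has a node at each synchronized level, summing over the intervals of a slab
  \<open>[\<alpha>, \<beta>]\<close> gives \<open>\<bar>W\<^sub>i t - F\<^sub>i \<alpha>\<bar> \<le> D G\<^sub>i\<close> with \<open>G\<^sub>i = \<integral>\<^sub>\<alpha>\<^sup>\<beta> \<bar>r\<^sub>i\<bar>\<close>, for all components at once although
  their intervals differ. The integral form of Minkowski's inequality (\<open>lp_norm_integral_le\<close>)
  bounds \<open>\<parallel>G\<parallel>\<^sub>p\<close> by \<open>K \<parallel>B\<parallel> sup \<parallel>W\<parallel>\<^sub>p\<close>, with no dependence on the number of components. If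
  \<open>2 D K \<parallel>B\<parallel> \<le> 1\<close>, the supremum can be absorbed: \<open>\<parallel>W\<parallel>\<^sub>p \<le> 2 \<parallel>F \<alpha>\<parallel>\<^sub>p\<close> on the slab, and
  \<open>\<parallel>F \<beta>\<parallel>\<^sub>p \<le> (1 + 2 K \<parallel>B\<parallel>) \<parallel>F \<alpha>\<parallel>\<^sub>p\<close>. Iterating over the slabs gives the exponential.
  
  The constant \<open>C = 6 D\<close> has the extra factor 3 because a dual solution, being continuous from the
  right in the variable of \<open>W\<close>, takes at \<open>T\<^sub>n\<close> a value that belongs to the slab \<open>n + 1\<close>; reaching
  that slab costs one more factor \<open>exp (K\<^sub>n C \<parallel>B\<parallel>) \<le> exp 1 \<le> 3\<close>.
\<close>

section \<open>The norms of vectors and matrices\<close>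

text \<open>
  This tangent inequality is the only form of convexity used: it yields both the triangle
  inequality and its integral version for the \<open>l\<^sub>p\<close> norms.
\<close>

lemma powr_above_tangent:
  fixes x y r :: real
  assumes "1 \<le> r" "0 \<le> x" "0 \<le> y"
  shows "y powr r + r * y powr (r - 1) * (x - y) \<le> x powr r"
proof (cases "y = 0")
  case True
  then show ?thesis by simp
next
  case False
  with assms have y: "y > 0" by simp
  show ?thesis
  proof (cases "x = 0")
    case True
    have "y powr r + r * y powr (r - 1) * (x - y) = (1 - r) * y powr r"
      using y True by (simp add: powr_diff algebra_simps)
    also have "\<dots> \<le> 0" using assms by (simp add: mult_nonpos_nonneg)
    finally show ?thesis using True by simp
  next
    case False
    have "(\<lambda>x. x powr r) x - (\<lambda>x. x powr r) y \<ge> (r * y powr (r - 1)) * (x - y)"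
    proof (rule convex_on_imp_above_tangent[where A = "{0<..}"])
      show "convex_on {0<..} (\<lambda>x. x powr r)" using assms by (intro powr_convex)
      show "y \<in> interior {0<..}" using y by (simp add: interior_open)
      show "((\<lambda>x. x powr r) has_real_derivative r * y powr (r - 1)) (at y within {0<..})"
        using y by (auto intro!: derivative_eq_intros)
    qed (use assms False in auto)
    then show ?thesis by simp
  qed
qed

lemma powr_convex_combination:
  fixes u v r \<theta> :: real
  assumes "1 \<le> r" "0 \<le> u" "0 \<le> v" "0 \<le> \<theta>" "\<theta> \<le> 1"
  shows "(\<theta> * u + (1 - \<theta>) * v) powr r \<le> \<theta> * u powr r + (1 - \<theta>) * v powr r"
proof -
  define w where "w = \<theta> * u + (1 - \<theta>) * v"
  have w: "0 \<le> w" using assms by (simp add: w_def)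
  have "\<theta> * (w powr r + r * w powr (r - 1) * (u - w)) \<le> \<theta> * u powr r"
    "(1 - \<theta>) * (w powr r + r * w powr (r - 1) * (v - w)) \<le> (1 - \<theta>) * v powr r"
    using assms w by (auto intro!: mult_left_mono powr_above_tangent)
  moreover have "\<theta> * (w powr r + r * w powr (r - 1) * (u - w))
      + (1 - \<theta>) * (w powr r + r * w powr (r - 1) * (v - w))
      = w powr r + r * w powr (r - 1) * (\<theta> * u + (1 - \<theta>) * v - w)"
    by (simp add: algebra_simps)
  ultimately show ?thesis by (simp add: w_def)
qed

lemma powr_le_cancel_exponent:
  fixes x y r :: real
  assumes "1 \<le> r" "0 \<le> x" "0 \<le> y"
  shows "x powr r \<le> y powr r \<longleftrightarrow> x \<le> y"
proof
  show "x \<le> y" if "x powr r \<le> y powr r"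
  proof (rule ccontr)
    assume "\<not> x \<le> y"
    then have "y powr r < x powr r" using assms by (intro powr_less_mono2) auto
    with that show False by simp
  qed
qed (use assms in \<open>auto intro: powr_mono2\<close>)

lemma lp_norm_infinity: "lp_norm N \<infinity> x = Max ((\<lambda>i. \<bar>x i\<bar>) ` {..<N})"
  by (simp add: lp_norm_def)

lemma lp_norm_ereal:
  "lp_norm N (ereal r) x = (\<Sum>i<N. \<bar>x i\<bar> powr r) powr (1 / r)"
  by (simp add: lp_norm_def)

lemma exponent_cases:
  assumes "1 \<le> (p :: ereal)"
  obtains "p = \<infinity>" | r where "p = ereal r" "1 \<le> r"
  using assms by (cases p) auto

lemma lp_norm_nonneg:
  assumes "1 \<le> N"
  shows "0 \<le> lp_norm N p x"
proof (cases "p = \<infinity>")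
  case True
  have "\<bar>x 0\<bar> \<le> Max ((\<lambda>i. \<bar>x i\<bar>) ` {..<N})"
    using assms by (intro Max_ge) auto
  then show ?thesis by (simp add: True lp_norm_infinity)
qed (simp add: lp_norm_def)

text \<open>
  Removing the outer root makes the powers accessible to convexity arguments; finite exponents
  are treated through this equivalence below.
\<close>

lemma lp_norm_ereal_le_iff:
  assumes "1 \<le> r" "0 \<le> Y"
  shows "lp_norm N (ereal r) x \<le> Y \<longleftrightarrow> (\<Sum>i<N. \<bar>x i\<bar> powr r) \<le> Y powr r"
proof -
  let ?S = "\<Sum>i<N. \<bar>x i\<bar> powr r"
  have S: "0 \<le> ?S" by (simp add: sum_nonneg)
  have "?S powr (1 / r) \<le> Y \<longleftrightarrow> (?S powr (1 / r)) powr r \<le> Y powr r"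
    using assms by (intro powr_le_cancel_exponent [symmetric]) auto
  also have "(?S powr (1 / r)) powr r = ?S"
    using assms S by (simp add: powr_powr)
  finally show ?thesis by (simp add: lp_norm_ereal)
qed

lemma lp_norm_infinity_le_iff:
  assumes "1 \<le> N"
  shows "lp_norm N \<infinity> x \<le> Y \<longleftrightarrow> (\<forall>i<N. \<bar>x i\<bar> \<le> Y)"
  using assms by (subst lp_norm_infinity, subst Max_le_iff) (auto simp: lessThan_empty_iff)

lemma lp_norm_mono:
  assumes "1 \<le> N" "1 \<le> p" "\<And>i. i < N \<Longrightarrow> \<bar>x i\<bar> \<le> \<bar>y i\<bar>"
  shows "lp_norm N p x \<le> lp_norm N p y"
proof -
  note nn = lp_norm_nonneg[OF assms(1), of p y]
  from assms(2) show ?thesis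
  proof (cases rule: exponent_cases)
    case 1
    have "\<forall>i<N. \<bar>y i\<bar> \<le> lp_norm N \<infinity> y"
      by (subst lp_norm_infinity_le_iff[OF assms(1), symmetric]) simp
    then show ?thesis
      unfolding 1 by (subst lp_norm_infinity_le_iff[OF assms(1)]) (use assms(3) order_trans in blast)
  next
    case (2 r)
    have "(\<Sum>i<N. \<bar>x i\<bar> powr r) \<le> (\<Sum>i<N. \<bar>y i\<bar> powr r)"
      using 2 assms(3) by (intro sum_mono powr_mono2) auto
    also have "\<dots> \<le> lp_norm N p y powr r"
      using lp_norm_ereal_le_iff[OF 2(2) nn, of N y] by (simp add: 2)
    finally show ?thesis
      using lp_norm_ereal_le_iff[OF 2(2) nn, of N x] by (simp add: 2)
  qed
qed

lemma lp_norm_cong: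
  assumes "\<And>i. i < N \<Longrightarrow> x i = y i"
  shows "lp_norm N p x = lp_norm N p y"
proof -
  have "(\<lambda>i. \<bar>x i\<bar>) ` {..<N} = (\<lambda>i. \<bar>y i\<bar>) ` {..<N}"
    by (intro image_cong) (simp_all add: assms)
  then show ?thesis
    using assms by (simp add: lp_norm_def)
qed

lemma lp_norm_scale_le:
  assumes "1 \<le> N" "1 \<le> p" "0 \<le> c"
  shows "lp_norm N p (\<lambda>i. c * x i) \<le> c * lp_norm N p x"
proof -
  note nn = lp_norm_nonneg[OF assms(1), of p x]
  from assms(2) show ?thesis
  proof (cases rule: exponent_cases)
    case 1
    have "\<forall>i<N. \<bar>x i\<bar> \<le> lp_norm N \<infinity> x"
      by (subst lp_norm_infinity_le_iff[OF assms(1), symmetric]) simp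
    then show ?thesis
      unfolding 1 by (subst lp_norm_infinity_le_iff[OF assms(1)])
        (use assms(3) in \<open>auto simp: abs_mult intro: mult_left_mono\<close>)
  next
    case (2 r)
    have "(\<Sum>i<N. \<bar>x i\<bar> powr r) \<le> lp_norm N p x powr r"
      using lp_norm_ereal_le_iff[OF 2(2) nn, of N x] by (simp add: 2)
    then have "c powr r * (\<Sum>i<N. \<bar>x i\<bar> powr r) \<le> c powr r * lp_norm N p x powr r"
      by (intro mult_left_mono) auto
    then have "(\<Sum>i<N. \<bar>c * x i\<bar> powr r) \<le> (c * lp_norm N p x) powr r"
      using assms(3) nn by (simp add: abs_mult powr_mult sum_distrib_left)
    moreover have "0 \<le> c * lp_norm N p x" using assms(3) nn by simp
    ultimately show ?thesis
      using lp_norm_ereal_le_iff[OF 2(2)] by (simp add: 2)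
  qed
qed

lemma abs_le_lp_norm:
  assumes "1 \<le> N" "1 \<le> p" "i < N"
  shows "\<bar>x i\<bar> \<le> lp_norm N p x"
  using assms(2)
proof (cases rule: exponent_cases)
  case 1
  have "\<forall>i<N. \<bar>x i\<bar> \<le> lp_norm N \<infinity> x"
    by (subst lp_norm_infinity_le_iff[OF assms(1), symmetric]) simp
  then show ?thesis using assms(3) 1 by simp
next
  case (2 r)
  note nn = lp_norm_nonneg[OF assms(1), of p x]
  have "\<bar>x i\<bar> powr r \<le> (\<Sum>i<N. \<bar>x i\<bar> powr r)"
    using assms(3) by (intro member_le_sum) auto
  also have "\<dots> \<le> lp_norm N p x powr r"
    using lp_norm_ereal_le_iff[OF 2(2) nn, of N x] by (simp add: 2)
  finally show ?thesis
    using 2(2) nn by (simp add: powr_le_cancel_exponent)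
qed

text \<open>
  With \<open>A = \<parallel>x\<parallel>\<close> and \<open>B = \<parallel>y\<parallel>\<close>, the vector \<open>(x + y) / (A + B)\<close> is a convex combination of the unit
  vectors \<open>x / A\<close> and \<open>y / B\<close>, and \<open>\<Sum> \<bar>z\<^sub>i\<bar>\<^sup>r\<close> is convex.
\<close>

lemma lp_norm_triangle:
  assumes "1 \<le> N" "1 \<le> p"
  shows "lp_norm N p (\<lambda>i. x i + y i) \<le> lp_norm N p x + lp_norm N p y"
proof -
  define A where "A = lp_norm N p x"
  define B where "B = lp_norm N p y"
  have AB: "0 \<le> A" "0 \<le> B" unfolding A_def B_def using lp_norm_nonneg[OF assms(1)] by auto
  have xA: "\<bar>x i\<bar> \<le> A" and yB: "\<bar>y i\<bar> \<le> B" if "i < N" for i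
    unfolding A_def B_def using abs_le_lp_norm[OF assms that] by auto
  consider "A = 0" | "B = 0" | "A > 0" "B > 0" using AB by linarith
  then show ?thesis
  proof cases
    case 1
    then have "lp_norm N p (\<lambda>i. x i + y i) = B"
      unfolding B_def using xA by (intro lp_norm_cong) force
    then show ?thesis using 1 by (simp add: A_def B_def)
  next
    case 2
    then have "lp_norm N p (\<lambda>i. x i + y i) = A"
      unfolding A_def using yB by (intro lp_norm_cong) force
    then show ?thesis using 2 by (simp add: A_def B_def)
  next
    case 3
    from assms(2) show ?thesis
    proof (cases rule: exponent_cases)
      case 1
      have "\<forall>i<N. \<bar>x i + y i\<bar> \<le> A + B" using xA yB by (meson abs_triangle_ineq add_mono order_trans)
      then show ?thesis
        unfolding 1 A_def B_def by (subst lp_norm_infinity_le_iff[OF assms(1)])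
    next
      case (2 r)
      define \<theta> where "\<theta> = A / (A + B)"
      have \<theta>: "0 \<le> \<theta>" "\<theta> \<le> 1" "1 - \<theta> = B / (A + B)"
        using 3 by (auto simp: \<theta>_def field_simps)
      have sx: "(\<Sum>i<N. \<bar>x i\<bar> powr r) \<le> A powr r" and sy: "(\<Sum>i<N. \<bar>y i\<bar> powr r) \<le> B powr r"
        using lp_norm_ereal_le_iff[OF 2(2) AB(1), of N x] lp_norm_ereal_le_iff[OF 2(2) AB(2), of N y]
        by (simp_all add: 2 A_def B_def)
      have pt: "\<bar>x i + y i\<bar> powr r \<le>
          (A + B) powr r * (\<theta> * (\<bar>x i\<bar> powr r / A powr r) + (1 - \<theta>) * (\<bar>y i\<bar> powr r / B powr r))" for i
      proof -
        have "\<bar>x i + y i\<bar> powr r \<le> (\<bar>x i\<bar> + \<bar>y i\<bar>) powr r"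
          using 2 by (intro powr_mono2) auto
        also have "\<bar>x i\<bar> + \<bar>y i\<bar> = (A + B) * (\<theta> * (\<bar>x i\<bar> / A) + (1 - \<theta>) * (\<bar>y i\<bar> / B))"
          unfolding \<theta>(3) unfolding \<theta>_def using 3 by (simp add: distrib_left)
        also have "\<dots> powr r = (A + B) powr r * (\<theta> * (\<bar>x i\<bar> / A) + (1 - \<theta>) * (\<bar>y i\<bar> / B)) powr r"
          using 3 \<theta> by (simp add: powr_mult)
        also have "(\<theta> * (\<bar>x i\<bar> / A) + (1 - \<theta>) * (\<bar>y i\<bar> / B)) powr r
            \<le> \<theta> * (\<bar>x i\<bar> / A) powr r + (1 - \<theta>) * (\<bar>y i\<bar> / B) powr r"
          using 2 \<theta> 3 by (intro powr_convex_combination[THEN order_trans]) (auto simp: powr_divide)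
        finally show ?thesis using 3 by (simp add: powr_divide mult_left_mono)
      qed
      have "(\<Sum>i<N. \<bar>x i + y i\<bar> powr r) \<le> (\<Sum>i<N. (A + B) powr r *
          (\<theta> * (\<bar>x i\<bar> powr r / A powr r) + (1 - \<theta>) * (\<bar>y i\<bar> powr r / B powr r)))"
        by (intro sum_mono pt)
      also have "\<dots> = (A + B) powr r * (\<theta> * ((\<Sum>i<N. \<bar>x i\<bar> powr r) / A powr r)
          + (1 - \<theta>) * ((\<Sum>i<N. \<bar>y i\<bar> powr r) / B powr r))"
        by (simp add: sum_distrib_left sum.distrib sum_divide_distrib distrib_left)
      also have "\<dots> \<le> (A + B) powr r * (\<theta> * 1 + (1 - \<theta>) * 1)"
        using 3 \<theta> sx sy by (intro mult_left_mono add_mono) (auto simp: divide_le_eq)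
      finally have "(\<Sum>i<N. \<bar>x i + y i\<bar> powr r) \<le> (A + B) powr r" by simp
      moreover have "0 \<le> A + B" using 3 by simp
      ultimately show ?thesis
        using lp_norm_ereal_le_iff[OF 2(2), of "A + B" N "\<lambda>i. x i + y i"]
        by (simp add: 2 A_def B_def)
    qed
  qed
qed

text \<open>
  The mean value of \<open>h\<close> lies in every closed convex set containing the values of \<open>h\<close>. For finite
  exponents this is Jensen's inequality: take the tangents at the mean values \<open>g\<^sub>i\<close>, sum over \<open>i\<close> and
  integrate; the linear terms integrate to zero. Working on the open interval leaves the end
  points free, where the discrete solutions may jump.
\<close>

lemma lp_norm_integral_le:
  fixes h :: "real \<Rightarrow> nat \<Rightarrow> real"
  assumes "1 \<le> N" "1 \<le> p" "a < b"
    and int: "\<And>i. i < N \<Longrightarrow> (\<lambda>s. h s i) integrable_on {a..b}"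
    and pos: "\<And>s i. i < N \<Longrightarrow> s \<in> {a<..<b} \<Longrightarrow> 0 \<le> h s i"
    and bnd: "\<And>s. s \<in> {a<..<b} \<Longrightarrow> lp_norm N p (h s) \<le> Y"
  shows "lp_norm N p (\<lambda>i. integral {a..b} (\<lambda>s. h s i)) \<le> (b - a) * Y"
proof -
  have Y: "0 \<le> Y"
    using bnd[of "(a + b) / 2"] lp_norm_nonneg[OF assms(1), of p "h ((a + b) / 2)"] \<open>a < b\<close>
    by (auto simp: field_simps)
  have intO: "(\<lambda>s. h s i) integrable_on {a<..<b}" if "i < N" for i
    using int[OF that] integrable_on_Icc_iff_Ioo by blast
  have eqO: "integral {a<..<b} (\<lambda>s. h s i) = integral {a..b} (\<lambda>s. h s i)" for i
    by (rule integral_open_interval_real [symmetric])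
  have cO: "((\<lambda>s. c) has_integral (b - a) * c) {a<..<b}" for c :: real
    using has_integral_const_real[of c a b] \<open>a < b\<close> by (simp add: has_integral_Icc_iff_Ioo)
  from assms(2) show ?thesis
  proof (cases rule: exponent_cases)
    case 1
    have "\<bar>integral {a..b} (\<lambda>s. h s i)\<bar> \<le> (b - a) * Y" if i: "i < N" for i
    proof -
      have "0 \<le> integral {a<..<b} (\<lambda>s. h s i)"
        using intO[OF i] pos[OF i] by (intro integral_nonneg) auto
      moreover have "integral {a<..<b} (\<lambda>s. h s i) \<le> (b - a) * Y"
      proof (rule has_integral_le[OF integrable_integral[OF intO[OF i]] cO])
        fix s assume "s \<in> {a<..<b}"
        then show "h s i \<le> Y"
          using abs_le_lp_norm[OF assms(1,2) i, of "h s"] bnd[of s] by simp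
      qed
      ultimately show ?thesis by (simp add: eqO)
    qed
    then show ?thesis unfolding 1 lp_norm_infinity_le_iff[OF assms(1)] by simp
  next
    case (2 r)
    define g where "g i = integral {a..b} (\<lambda>s. h s i) / (b - a)" for i
    have g: "0 \<le> g i" if i: "i < N" for i
      using integral_nonneg[OF intO[OF i] pos[OF i]] \<open>a < b\<close> unfolding g_def eqO[symmetric] by simp
    have "((\<lambda>s. g i powr r + r * g i powr (r - 1) * (h s i - g i)) has_integral
        (b - a) * g i powr r + r * g i powr (r - 1) * (integral {a..b} (\<lambda>s. h s i) - (b - a) * g i))
        {a<..<b}" if i: "i < N" for i
      using integrable_integral[OF intO[OF i]] unfolding eqO
      by (intro has_integral_add has_integral_mult_right has_integral_diff cO)
    then have "((\<lambda>s. g i powr r + r * g i powr (r - 1) * (h s i - g i)) has_integral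
        (b - a) * g i powr r) {a<..<b}" if i: "i < N" for i
      using i \<open>a < b\<close> by (simp add: g_def)
    then have "((\<lambda>s. \<Sum>i<N. g i powr r + r * g i powr (r - 1) * (h s i - g i)) has_integral
        (\<Sum>i<N. (b - a) * g i powr r)) {a<..<b}"
      by (intro has_integral_sum) auto
    then have "(\<Sum>i<N. (b - a) * g i powr r) \<le> (b - a) * Y powr r"
    proof (rule has_integral_le[OF _ cO])
      fix s assume s: "s \<in> {a<..<b}"
      have "(\<Sum>i<N. g i powr r + r * g i powr (r - 1) * (h s i - g i)) \<le> (\<Sum>i<N. \<bar>h s i\<bar> powr r)"
        using g pos[OF _ s] by (intro sum_mono) (simp add: powr_above_tangent[OF 2(2)])
      also have "\<dots> \<le> Y powr r"
        using bnd[OF s] lp_norm_ereal_le_iff[OF 2(2) Y, of N "h s"] by (simp add: 2)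
      finally show "(\<Sum>i<N. g i powr r + r * g i powr (r - 1) * (h s i - g i)) \<le> Y powr r" .
    qed
    then have "(\<Sum>i<N. \<bar>g i\<bar> powr r) \<le> Y powr r"
      using g \<open>a < b\<close> by (simp add: sum_distrib_left[symmetric])
    then have "lp_norm N p g \<le> Y"
      using lp_norm_ereal_le_iff[OF 2(2) Y, of N g] by (simp add: 2)
    then have "(b - a) * lp_norm N p g \<le> (b - a) * Y" using \<open>a < b\<close> by simp
    moreover have "lp_norm N p (\<lambda>i. (b - a) * g i) \<le> (b - a) * lp_norm N p g"
      using \<open>a < b\<close> by (intro lp_norm_scale_le assms) auto
    moreover have "(\<lambda>i. (b - a) * g i) = (\<lambda>i. integral {a..b} (\<lambda>s. h s i))"
      using \<open>a < b\<close> by (auto simp: g_def)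
    ultimately show ?thesis by simp
  qed
qed

text \<open>
  A crude bound in terms of the entries. It guarantees that the suprema defining the operator norm
  and its maximum over a slab are taken over bounded sets.
\<close>

lemma lp_norm_mat_vec_le_entries:
  assumes "1 \<le> N" "1 \<le> p" "\<And>i j. i < N \<Longrightarrow> j < N \<Longrightarrow> \<bar>A i j\<bar> \<le> R" "0 \<le> R"
  shows "lp_norm N p (mat_vec N A x) \<le> real N * R * lp_norm N p (\<lambda>_. 1) * lp_norm N p x"
proof -
  note nn = lp_norm_nonneg[OF assms(1)]
  have e: "\<bar>mat_vec N A x i\<bar> \<le> real N * R * lp_norm N p x" if i: "i < N" for i
  proof -
    have "\<bar>mat_vec N A x i\<bar> \<le> (\<Sum>j<N. \<bar>A i j * x j\<bar>)"
      unfolding mat_vec_def by (rule sum_abs)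
    also have "\<dots> \<le> (\<Sum>j<N. R * lp_norm N p x)"
      using assms i abs_le_lp_norm[OF assms(1,2)] by (intro sum_mono) (auto simp: abs_mult intro!: mult_mono)
    finally show ?thesis by simp
  qed
  have "lp_norm N p (mat_vec N A x) \<le> lp_norm N p (\<lambda>_. real N * R * lp_norm N p x * 1)"
    using e assms nn by (intro lp_norm_mono) (auto simp: abs_mult)
  also have "\<dots> \<le> real N * R * lp_norm N p x * lp_norm N p (\<lambda>_. 1)"
    using assms nn by (intro lp_norm_scale_le) auto
  finally show ?thesis by (simp add: mult_ac)
qed

lemma lp_norm_one_pos:
  assumes "1 \<le> N" "1 \<le> p"
  shows "0 < lp_norm N p (\<lambda>_. 1)"
  using abs_le_lp_norm[OF assms, of 0 "\<lambda>_. 1"] assms by simp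

lemma lp_opnorm_le:
  assumes "1 \<le> N" "1 \<le> p" "\<And>i j. i < N \<Longrightarrow> j < N \<Longrightarrow> \<bar>A i j\<bar> \<le> R" "0 \<le> R"
  shows "lp_opnorm N p A \<le> real N * R * lp_norm N p (\<lambda>_. 1)"
  unfolding lp_opnorm_def
proof (rule cSUP_least)
  show "{x. lp_norm N p x \<noteq> 0} \<noteq> {}" using lp_norm_one_pos[OF assms(1,2)] by force
next
  fix x assume "x \<in> {x. lp_norm N p x \<noteq> 0}"
  with lp_norm_nonneg[OF assms(1)] have "lp_norm N p x > 0"
    by (metis less_eq_real_def mem_Collect_eq)
  then show "lp_norm N p (mat_vec N A x) / lp_norm N p x \<le> real N * R * lp_norm N p (\<lambda>_. 1)"
    using lp_norm_mat_vec_le_entries[OF assms, where x = x] by (simp add: divide_le_eq)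
qed

lemma lp_norm_mat_vec_le:
  assumes "1 \<le> N" "1 \<le> p"
  shows "lp_norm N p (mat_vec N A x) \<le> lp_opnorm N p A * lp_norm N p x"
proof -
  define R where "R = (\<Sum>i<N. \<Sum>j<N. \<bar>A i j\<bar>)"
  have R0: "0 \<le> R" unfolding R_def by (intro sum_nonneg) auto
  have R: "\<bar>A i j\<bar> \<le> R" if "i < N" "j < N" for i j
  proof -
    have "\<bar>A i j\<bar> \<le> (\<Sum>j<N. \<bar>A i j\<bar>)" using that by (intro member_le_sum) auto
    also have "\<dots> \<le> R" unfolding R_def using that
      by (intro member_le_sum[of i "{..<N}" "\<lambda>i. \<Sum>j<N. \<bar>A i j\<bar>"]) (auto intro: sum_nonneg)
    finally show ?thesis .
  qed
  note b = lp_norm_mat_vec_le_entries[where A = A, OF assms R R0]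
  note nn = lp_norm_nonneg[OF assms(1)]
  show ?thesis
  proof (cases "lp_norm N p x = 0")
    case True
    then show ?thesis using b[of x] by simp
  next
    case False
    with nn[of p x] have pos: "lp_norm N p x > 0" by linarith
    have "bdd_above ((\<lambda>x. lp_norm N p (mat_vec N A x) / lp_norm N p x) ` {x. lp_norm N p x \<noteq> 0})"
    proof (rule bdd_aboveI2)
      fix x assume "x \<in> {x. lp_norm N p x \<noteq> 0}"
      then have "lp_norm N p x > 0" using nn[of p x] by simp
      then show "lp_norm N p (mat_vec N A x) / lp_norm N p x \<le> real N * R * lp_norm N p (\<lambda>_. 1)"
        using b[of x] by (simp add: divide_le_eq)
    qed
    then have "lp_norm N p (mat_vec N A x) / lp_norm N p x \<le> lp_opnorm N p A"
      unfolding lp_opnorm_def using False by (intro cSUP_upper) auto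
    then show ?thesis using pos by (simp add: divide_le_eq)
  qed
qed

lemma lp_opnorm_nonneg:
  assumes "1 \<le> N" "1 \<le> p"
  shows "0 \<le> lp_opnorm N p A"
  using lp_norm_mat_vec_le[OF assms, of A "\<lambda>_. 1"] lp_norm_one_pos[OF assms]
    lp_norm_nonneg[OF assms(1), of p "mat_vec N A (\<lambda>_. 1)"]
  by (meson dual_order.trans zero_le_mult_iff not_le)

section \<open>An inverse inequality for polynomials\<close>

text \<open>
  Induction on the degree: \<open>f(y) = f(z) + (y - z) g(y)\<close> with \<open>z\<close> one of the points, and
  \<open>g(x) = (f(x) - f(z)) / (x - z)\<close> is at most \<open>2 m / d\<close> at the remaining ones.
\<close>

lemma poly_bound_from_separated_points:
  fixes f :: "real poly"
  assumes "degree f \<le> q" "0 < d" "0 \<le> L" "0 \<le> m"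
    and "\<And>k. k \<le> q \<Longrightarrow> \<bar>poly f (x k)\<bar> \<le> m"
    and "\<And>k l. k \<le> q \<Longrightarrow> l \<le> q \<Longrightarrow> k \<noteq> l \<Longrightarrow> d \<le> \<bar>x k - x l\<bar>"
    and "\<And>k. k \<le> q \<Longrightarrow> \<bar>y - x k\<bar> \<le> L"
  shows "\<bar>poly f y\<bar> \<le> (1 + 2 * L / d) ^ q * m"
  using assms
proof (induction q arbitrary: f m)
  case 0
  then have "poly f y = poly f (x 0)"
    by (metis degree_eq_zeroE le_zero_eq mult_zero_right poly_0 poly_pCons add.right_neutral)
  with 0 show ?case by simp
next
  case (Suc q)
  define z where "z = x (Suc q)"
  define g where "g = synthetic_div f z"
  have fg: "poly f t = poly f z + (t - z) * poly g t" for t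
  proof -
    have "poly f t = poly (pCons (poly f z) g + smult (- z) g) t"
      using synthetic_div_correct'[of z f] 
      by (metis (no_types, lifting) g_def synthetic_div_correct add_diff_cancel_right' diff_conv_add_uminus smult_minus_left)
    then show ?thesis by (simp add: algebra_simps)
  qed
  have dg: "degree g \<le> q" using Suc.prems(1) by (simp add: g_def degree_synthetic_div)
  have bg: "\<bar>poly g (x k)\<bar> \<le> 2 * m / d" if "k \<le> q" for k
  proof -
    have 1: "d \<le> \<bar>x k - z\<bar>" unfolding z_def using that Suc.prems(6)[of k "Suc q"] by auto
    have 2: "\<bar>poly f (x k)\<bar> \<le> m" "\<bar>poly f z\<bar> \<le> m"
      unfolding z_def using that Suc.prems(5) by auto
    have "d * \<bar>poly g (x k)\<bar> \<le> \<bar>x k - z\<bar> * \<bar>poly g (x k)\<bar>"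
      using 1 by (intro mult_right_mono) auto
    also have "\<dots> = \<bar>poly f (x k) - poly f z\<bar>" using fg[of "x k"] by (simp add: abs_mult)
    also have "\<dots> \<le> 2 * m" using 2 by linarith
    finally show ?thesis using \<open>0 < d\<close> by (simp add: field_simps)
  qed
  have "0 \<le> 2 * m / d" using Suc.prems by simp
  then have "\<bar>poly g y\<bar> \<le> (1 + 2 * L / d) ^ q * (2 * m / d)"
    using Suc.prems dg bg by (intro Suc.IH) auto
  then have "\<bar>(y - z) * poly g y\<bar> \<le> L * ((1 + 2 * L / d) ^ q * (2 * m / d))"
    unfolding abs_mult z_def using Suc.prems(3,7) by (intro mult_mono) auto
  moreover have "\<bar>poly f z\<bar> \<le> m" unfolding z_def using Suc.prems(5) by auto
  moreover have "\<bar>poly f y\<bar> \<le> \<bar>poly f z\<bar> + \<bar>(y - z) * poly g y\<bar>"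
    unfolding fg[of y] by (rule abs_triangle_ineq)
  moreover have "m \<le> (1 + 2 * L / d) ^ q * m"
  proof -
    have "1 \<le> (1 + 2 * L / d) ^ q" using Suc.prems by (intro one_le_power) auto
    then show ?thesis using Suc.prems(4) by (simp add: mult_le_cancel_right1)
  qed
  ultimately have "\<bar>poly f y\<bar> \<le> (1 + 2 * L / d) ^ q * m + L * ((1 + 2 * L / d) ^ q * (2 * m / d))"
    by linarith
  also have "\<dots> = (1 + 2 * L / d) ^ Suc q * m" by (simp add: algebra_simps)
  finally show ?case .
qed

definition inverse_const :: "nat \<Rightarrow> real" where
  "inverse_const q = (2 * real q + 3) ^ 3 * ((1 + 2 * (2 * real q + 3)) ^ q)\<^sup>2"

lemma inverse_const_ge_1: "1 \<le> inverse_const q"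
proof -
  have "1 * 1\<^sup>2 \<le> inverse_const q"
    unfolding inverse_const_def by (intro mult_mono power_mono one_le_power) auto
  then show ?thesis by simp
qed

text \<open>
  Cut \<open>[a, b]\<close> into \<open>2 q + 3\<close> parts of length \<open>h\<close> and keep every second one, starting with the second:
  these \<open>q + 1\<close> parts are \<open>h\<close> apart and at distance at least \<open>h\<close> from the ends, so the weight is at
  least \<open>h\<^sup>2\<close> there. On each of them the integral controls the minimum of \<open>f\<^sup>2\<close>, and a polynomial of
  degree \<open>q\<close> is controlled by its values at \<open>q + 1\<close> separated points. The weight vanishes at both
  ends because the energies of the two discontinuous methods carry \<open>s - a\<close> or \<open>b - s\<close>.
\<close>

lemma weighted_inverse_inequality:
  fixes f :: "real poly"
  assumes "degree f \<le> q" "a < b" "y \<in> {a..b}"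
  shows "(b - a) ^ 3 * (poly f y)\<^sup>2
    \<le> inverse_const q * integral {a..b} (\<lambda>s. (s - a) * (b - s) * (poly f s)\<^sup>2)"
proof -
  define n where "n = 2 * real q + 3"
  define h where "h = (b - a) / n"
  define w where "w s = (s - a) * (b - s) * (poly f s)\<^sup>2" for s
  define I where "I = integral {a..b} w"
  have n: "n > 0" by (simp add: n_def)
  have h: "h > 0" "n * h = b - a" using n assms by (simp_all add: h_def)
  have wint: "w integrable_on {c..d}" for c d
    unfolding w_def by (intro integrable_continuous_interval continuous_intros)
  have wpos: "0 \<le> w s" if "s \<in> {a..b}" for s using that by (simp add: w_def)
  define l where "l k = a + (2 * real k + 1) * h" for k
  have lk: "a + h \<le> l k" "l k + h \<le> b - h" if "k \<le> q" for k
  proof -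
    have "(2 * real k + 3) * h \<le> n * h"
      using that h(1) by (intro mult_right_mono) (auto simp: n_def)
    moreover have "1 * h \<le> (2 * real k + 1) * h" using h(1) by (intro mult_right_mono) auto
    ultimately show "a + h \<le> l k" "l k + h \<le> b - h" unfolding h(2) by (simp_all add: l_def algebra_simps)
  qed
  have "\<exists>x\<in>{l k..l k + h}. \<forall>t\<in>{l k..l k + h}. (poly f x)\<^sup>2 \<le> (poly f t)\<^sup>2" for k
    using h by (intro continuous_attains_inf) (auto intro!: continuous_intros)
  then obtain x where x: "\<And>k. x k \<in> {l k..l k + h}"
    "\<And>k t. t \<in> {l k..l k + h} \<Longrightarrow> (poly f (x k))\<^sup>2 \<le> (poly f t)\<^sup>2" by metis
  have sq: "h ^ 3 * (poly f (x k))\<^sup>2 \<le> I" if "k \<le> q" for k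
  proof -
    have "h ^ 3 * (poly f (x k))\<^sup>2 = integral {l k..l k + h} (\<lambda>_. h\<^sup>2 * (poly f (x k))\<^sup>2)"
      using h by (simp add: power3_eq_cube power2_eq_square)
    also have "\<dots> \<le> integral {l k..l k + h} w"
    proof (intro integral_le wint integrable_const_ivl)
      fix t assume t: "t \<in> {l k..l k + h}"
      then have "h \<le> t - a" "h \<le> b - t" using lk[OF that] by auto
      then have hh: "h\<^sup>2 \<le> (t - a) * (b - t)"
        unfolding power2_eq_square using h by (intro mult_mono) auto
      have "0 \<le> (t - a) * (b - t)" using hh zero_le_power2[of h] by linarith
      then show "h\<^sup>2 * (poly f (x k))\<^sup>2 \<le> w t"
        unfolding w_def by (intro mult_mono[OF hh x(2)[OF t]]) auto
    qed
    also have "\<dots> \<le> I"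
      unfolding I_def using lk[OF that] h wpos wint by (intro integral_subset_le) auto
    finally show ?thesis .
  qed
  have I: "0 \<le> I" unfolding I_def by (intro integral_nonneg wint wpos)
  define m where "m = sqrt (I / h ^ 3)"
  have "\<bar>poly f y\<bar> \<le> (1 + 2 * (b - a) / h) ^ q * m"
  proof (rule poly_bound_from_separated_points[OF assms(1) h(1)])
    show "0 \<le> b - a" using assms by simp
    show "0 \<le> m" using I h by (simp add: m_def)
    show "\<bar>poly f (x k)\<bar> \<le> m" if "k \<le> q" for k
      unfolding m_def using sq[OF that] h by (intro real_le_rsqrt) (simp add: field_simps)
    show "\<bar>y - x k\<bar> \<le> b - a" if "k \<le> q" for k
      using lk[OF that] x(1)[of k] assms h by auto
    show "h \<le> \<bar>x k - x k'\<bar>" if "k \<le> q" "k' \<le> q" "k \<noteq> k'" for k k'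
    proof -
      have *: "h \<le> x j - x i" if "i < j" for i j
      proof -
        have "2 * real i + 3 \<le> 2 * real j + 1" using that by linarith
        then have "(2 * real i + 3) * h \<le> (2 * real j + 1) * h" using h by (intro mult_right_mono) auto
        then have "l i + h + h \<le> l j" by (simp add: l_def algebra_simps)
        then show ?thesis using x(1)[of i] x(1)[of j] by auto
      qed
      from that(3) consider "k < k'" | "k' < k" by linarith
      then show ?thesis using *[of k k'] *[of k' k] by cases auto
    qed
  qed
  moreover have "(b - a) / h = n" using h n by (simp add: field_simps)
  ultimately have "\<bar>poly f y\<bar> \<le> (1 + 2 * n) ^ q * m"
    by (metis times_divide_eq_right)
  then have "\<bar>poly f y\<bar>\<^sup>2 \<le> ((1 + 2 * n) ^ q * m)\<^sup>2" by (intro power_mono) auto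
  then have "(poly f y)\<^sup>2 \<le> ((1 + 2 * n) ^ q)\<^sup>2 * (I / h ^ 3)"
    using I h by (simp add: power_mult_distrib m_def)
  then have "(n * h) ^ 3 * (poly f y)\<^sup>2 \<le> (n * h) ^ 3 * (((1 + 2 * n) ^ q)\<^sup>2 * (I / h ^ 3))"
    using n h assms(2) by (intro mult_left_mono) auto
  also have "\<dots> = n ^ 3 * ((1 + 2 * n) ^ q)\<^sup>2 * I"
    using h(1) by (simp add: power_mult_distrib)
  finally show ?thesis
    unfolding h(2) unfolding inverse_const_def n_def I_def w_def .
qed

section \<open>Grids, integrability and calculus of piecewise polynomials\<close>

definition grid :: "(nat \<Rightarrow> real) \<Rightarrow> nat \<Rightarrow> bool" where
  "grid x n \<longleftrightarrow> (\<forall>j\<in>{1..n}. x (j - 1) < x j)"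

lemma grid_less:
  assumes "grid x n" "k < l" "l \<le> n"
  shows "x k < x l"
  using assms(2,3)
proof (induction l)
  case (Suc l)
  have "x l < x (Suc l)" using assms(1) Suc.prems by (auto simp: grid_def dest: bspec[of _ _ "Suc l"])
  moreover have "x k \<le> x l" using Suc by (cases "k = l") (auto intro: less_imp_le)
  ultimately show ?case by simp
qed simp

lemma grid_le:
  assumes "grid x n" "k \<le> l" "l \<le> n"
  shows "x k \<le> x l"
  using grid_less[OF assms(1)] assms(2,3) by (cases "k = l") (auto intro: less_imp_le)

lemma grid_locate_left_open:
  fixes x :: "nat \<Rightarrow> real"
  assumes "x 0 < t" "t \<le> x n"
  shows "\<exists>j\<in>{1..n}. x (j - 1) < t \<and> t \<le> x j"
proof -
  define j where "j = (LEAST j. t \<le> x j)"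
  have j: "t \<le> x j" unfolding j_def by (rule LeastI[of _ n]) (rule assms)
  have "j \<le> n" unfolding j_def by (rule Least_le) (rule assms)
  moreover have "j \<noteq> 0" using j assms(1) by (metis not_le)
  moreover have "\<not> t \<le> x (j - 1)"
    using not_less_Least[of "j - 1" "\<lambda>j. t \<le> x j"] \<open>j \<noteq> 0\<close> by (simp add: j_def)
  ultimately show ?thesis using j by (intro bexI[of _ j]) auto
qed

lemma grid_locate_right_open:
  fixes x :: "nat \<Rightarrow> real"
  assumes "x 0 \<le> t" "t < x n"
  shows "\<exists>j\<in>{1..n}. x (j - 1) \<le> t \<and> t < x j"
proof -
  define j where "j = (LEAST j. t < x j)"
  have j: "t < x j" unfolding j_def by (rule LeastI[of _ n]) (rule assms)
  have "j \<le> n" unfolding j_def by (rule Least_le) (rule assms)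
  moreover have "j \<noteq> 0" using j assms(1) by (metis not_le)
  moreover have "\<not> t < x (j - 1)"
    using not_less_Least[of "j - 1" "\<lambda>j. t < x j"] \<open>j \<noteq> 0\<close> by (simp add: j_def)
  ultimately show ?thesis using j by (intro bexI[of _ j]) auto
qed

lemma grid_piece_between_nodes:
  assumes "grid x n" "j \<in> {1..n}" "k \<le> n"
  shows "x j \<le> x k \<or> x k \<le> x (j - 1)"
  using grid_le[OF assms(1), of j k] grid_le[OF assms(1), of k "j - 1"] assms(2,3) by force

lemma grid_pieces_disjoint:
  assumes "grid x n" "j \<in> {1..n}" "l \<in> {1..n}" "l \<noteq> j" "s \<in> {x (l - 1)<..x l}"
  shows "s \<notin> {x (j - 1)<..x j}"
proof (cases "l < j")
  case True
  then have "x l \<le> x (j - 1)" using assms(2) by (intro grid_le[OF assms(1)]) auto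
  then show ?thesis using assms(5) by auto
next
  case False
  then have "x j \<le> x (l - 1)" using assms(3,4) by (intro grid_le[OF assms(1)]) auto
  then show ?thesis using assms(5) by auto
qed

text \<open>
  The class of scalar functions in which all integrands below lie: it is closed under products, in
  contrast to integrability, and contains piecewise polynomials.
\<close>

definition bounded_measurable_on :: "real \<Rightarrow> real \<Rightarrow> (real \<Rightarrow> real) \<Rightarrow> bool" where
  "bounded_measurable_on a b f \<longleftrightarrow>
     f \<in> borel_measurable (lebesgue_on {a..b}) \<and> bounded (f ` {a..b})"

lemma bounded_measurable_onI:
  assumes "f \<in> borel_measurable (lebesgue_on {a..b})" "\<And>s. s \<in> {a..b} \<Longrightarrow> \<bar>f s\<bar> \<le> K"
  shows "bounded_measurable_on a b f"
  unfolding bounded_measurable_on_def bounded_iff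
  using assms by (auto intro!: exI[of _ K] simp: real_norm_def)

lemma bounded_measurable_onE:
  assumes "bounded_measurable_on a b f"
  obtains K where "f \<in> borel_measurable (lebesgue_on {a..b})" "\<forall>s\<in>{a..b}. \<bar>f s\<bar> \<le> K"
proof -
  obtain K where "\<forall>y\<in>f ` {a..b}. norm y \<le> K"
    using assms unfolding bounded_measurable_on_def bounded_iff by blast
  then have "\<forall>s\<in>{a..b}. \<bar>f s\<bar> \<le> K" by (metis imageI real_norm_def)
  with that show thesis using assms by (simp add: bounded_measurable_on_def)
qed

lemma bounded_measurable_on_mult:
  assumes "bounded_measurable_on a b f" "bounded_measurable_on a b g"
  shows "bounded_measurable_on a b (\<lambda>s. f s * g s)"
proof -
  obtain K L where m: "f \<in> borel_measurable (lebesgue_on {a..b})" "g \<in> borel_measurable (lebesgue_on {a..b})"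
    and KL: "\<forall>s\<in>{a..b}. \<bar>f s\<bar> \<le> K" "\<forall>s\<in>{a..b}. \<bar>g s\<bar> \<le> L"
    using assms by (metis bounded_measurable_onE)
  have "\<bar>f s * g s\<bar> \<le> K * L" if "s \<in> {a..b}" for s
    unfolding abs_mult using that KL by (intro mult_mono) (auto intro: order_trans[OF abs_ge_zero])
  then show ?thesis using m by (intro bounded_measurable_onI[of _ _ _ "K * L"]) auto
qed

lemma bounded_measurable_on_sum:
  assumes "\<And>i. i \<in> I \<Longrightarrow> bounded_measurable_on a b (f i)"
  shows "bounded_measurable_on a b (\<lambda>s. \<Sum>i\<in>I. f i s)"
proof -
  have "\<exists>K. \<forall>s\<in>{a..b}. \<bar>f i s\<bar> \<le> K" if "i \<in> I" for i
    using assms[OF that] by (metis bounded_measurable_onE)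
  then obtain K where K: "\<And>i s. i \<in> I \<Longrightarrow> s \<in> {a..b} \<Longrightarrow> \<bar>f i s\<bar> \<le> K i" by metis
  show ?thesis
  proof (rule bounded_measurable_onI)
    show "\<bar>\<Sum>i\<in>I. f i s\<bar> \<le> (\<Sum>i\<in>I. K i)" if "s \<in> {a..b}" for s
      using K that by (intro order_trans[OF sum_abs] sum_mono)
    show "(\<lambda>s. \<Sum>i\<in>I. f i s) \<in> borel_measurable (lebesgue_on {a..b})"
      using assms by (intro borel_measurable_sum) (auto simp: bounded_measurable_on_def)
  qed
qed

lemma bounded_measurable_on_continuous:
  assumes "continuous_on {a..b} f"
  shows "bounded_measurable_on a b f"
  using assms continuous_imp_measurable_on_sets_lebesgue[OF assms]
    compact_imp_bounded[OF compact_continuous_image[OF assms]]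
  by (auto simp: bounded_measurable_on_def)

lemma bounded_measurable_on_subinterval:
  assumes "bounded_measurable_on a b f" "{c..d} \<subseteq> {a..b}"
  shows "bounded_measurable_on c d f"
  using assms bounded_subset[OF _ image_mono[OF assms(2)]]
  unfolding bounded_measurable_on_def
  by (metis measurable_restrict_mono)

lemma bounded_measurable_on_integrable:
  assumes "bounded_measurable_on a b f"
  shows "f integrable_on {a..b}" "(\<lambda>s. \<bar>f s\<bar>) integrable_on {a..b}"
proof -
  obtain K where "\<forall>s\<in>{a..b}. \<bar>f s\<bar> \<le> K"
    using assms by (rule bounded_measurable_onE)
  then have "f absolutely_integrable_on {a..b}"
    using assms unfolding bounded_measurable_on_def
    by (intro measurable_bounded_by_integrable_imp_absolutely_integrable[where g = "\<lambda>_. K"]) auto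
  then show "f integrable_on {a..b}" "(\<lambda>s. \<bar>f s\<bar>) integrable_on {a..b}"
    by (auto simp: absolutely_integrable_on_def)
qed

text \<open>
  Nothing is assumed about the values at the nodes, so the same lemma serves left-open and
  right-open pieces.
\<close>

lemma bounded_measurable_on_piecewise_poly:
  assumes "grid x n" "\<And>j s. j \<in> {1..n} \<Longrightarrow> s \<in> {x (j - 1)<..<x j} \<Longrightarrow> u s = poly (f j) s"
  shows "bounded_measurable_on (x 0) (x n) u"
  using assms
proof (induction n)
  case 0
  have "u integrable_on {x 0..x 0}" using integrable_on_refl[of u "x 0"] by simp
  then have "u \<in> borel_measurable (lebesgue_on {x 0..x 0})" by (rule integrable_imp_measurable)
  then show ?case by (rule bounded_measurable_onI[of _ _ _ "\<bar>u (x 0)\<bar>"]) auto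
next
  case (Suc n)
  have g: "grid x n" using Suc.prems(1) by (auto simp: grid_def)
  have IH: "bounded_measurable_on (x 0) (x n) u"
    using Suc.prems(2) by (intro Suc.IH[OF g]) auto
  have le: "x 0 \<le> x n" "x n < x (Suc n)"
    using grid_le[OF Suc.prems(1), of 0 n] grid_less[OF Suc.prems(1), of n "Suc n"] by auto
  have eq: "u s = poly (f (Suc n)) s" if "s \<in> {x n<..<x (Suc n)}" for s
    using Suc.prems(2)[of "Suc n" s] that by auto
  have "u integrable_on {x n..x (Suc n)}"
  proof (rule integrable_spike[of "poly (f (Suc n))" _ "{x n, x (Suc n)}"])
    show "poly (f (Suc n)) integrable_on {x n..x (Suc n)}"
      by (intro integrable_continuous_interval continuous_intros)
  qed (use eq in auto)
  then have "u integrable_on {x 0..x (Suc n)}"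
    using le by (intro Henstock_Kurzweil_Integration.integrable_combine
        [OF le(1) _ bounded_measurable_on_integrable(1)[OF IH]]) auto
  then have "u \<in> borel_measurable (lebesgue_on {x 0..x (Suc n)})"
    by (rule integrable_imp_measurable)
  moreover have "bounded (u ` {x 0..x (Suc n)})"
  proof (rule bounded_subset)
    show "bounded (u ` {x 0..x n} \<union> poly (f (Suc n)) ` {x n..x (Suc n)} \<union> {u (x (Suc n))})"
      using IH unfolding bounded_measurable_on_def
      by (auto intro!: compact_imp_bounded compact_continuous_image continuous_intros)
    show "u ` {x 0..x (Suc n)} \<subseteq> u ` {x 0..x n} \<union> poly (f (Suc n)) ` {x n..x (Suc n)} \<union> {u (x (Suc n))}"
    proof
      fix y assume "y \<in> u ` {x 0..x (Suc n)}"
      then obtain s where s: "y = u s" "x 0 \<le> s" "s \<le> x (Suc n)" by auto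
      then consider "s \<le> x n" | "s \<in> {x n<..<x (Suc n)}" | "s = x (Suc n)" by force
      then show "y \<in> u ` {x 0..x n} \<union> poly (f (Suc n)) ` {x n..x (Suc n)} \<union> {u (x (Suc n))}"
        using s eq[of s] by cases auto
    qed
  qed
  ultimately show ?case by (simp add: bounded_measurable_on_def)
qed

text \<open>
  The reduction of equations over \<open>[0, T]\<close> to a single interval; at \<open>a\<close> and \<open>b\<close> the integrand may be
  anything, as derivatives and piecewise values are arbitrary there.
\<close>

lemma integral_localize:
  fixes g h :: "real \<Rightarrow> real"
  assumes "{a..b} \<subseteq> {c..d}" "\<And>s. s \<in> {a<..<b} \<Longrightarrow> g s = h s"
    "\<And>s. s \<in> {c..d} - {a..b} \<Longrightarrow> g s = 0"
  shows "integral {c..d} g = integral {a..b} h"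
proof -
  have "integral {c..d} g = integral {c..d} (\<lambda>s. if s \<in> {a..b} then h s else 0)"
    by (rule integral_spike[of "{a, b}"]) (use assms in \<open>auto simp: less_le\<close>)
  also have "\<dots> = integral ({a..b} \<inter> {c..d}) h"
    by (rule Henstock_Kurzweil_Integration.integral_restrict_Int)
  also have "{a..b} \<inter> {c..d} = {a..b}" using assms(1) by blast
  finally show ?thesis .
qed

lemma tendsto_at_right_poly:
  assumes "a < (b::real)" "\<And>s. s \<in> {a<..<b} \<Longrightarrow> u s = poly f s"
  shows "(u \<longlongrightarrow> poly f a) (at_right a)"
proof (rule Lim_transform_eventually)
  show "(poly f \<longlongrightarrow> poly f a) (at_right a)" by (intro tendsto_intros)
  show "\<forall>\<^sub>F s in at_right a. poly f s = u s"
    using assms by (auto simp: eventually_at_right intro!: exI[of _ b])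
qed

lemma tendsto_at_left_poly:
  assumes "a < (b::real)" "\<And>s. s \<in> {a<..<b} \<Longrightarrow> u s = poly f s"
  shows "(u \<longlongrightarrow> poly f b) (at_left b)"
proof (rule Lim_transform_eventually)
  show "(poly f \<longlongrightarrow> poly f b) (at_left b)" by (intro tendsto_intros)
  show "\<forall>\<^sub>F s in at_left b. poly f s = u s"
    using assms by (auto simp: eventually_at_left intro!: exI[of _ a])
qed

lemma right_lim_eq: "(u \<longlongrightarrow> l) (at_right s) \<Longrightarrow> right_lim u s = l"
  unfolding right_lim_def by (rule tendsto_Lim) auto

lemma left_lim_eq: "(u \<longlongrightarrow> l) (at_left s) \<Longrightarrow> left_lim u s = l"
  unfolding left_lim_def by (rule tendsto_Lim) auto

lemma deriv_eq_poly_pderiv: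
  assumes "\<And>s. s \<in> {a<..<b} \<Longrightarrow> u s = poly f s" "s \<in> {a<..<b}"
  shows "deriv u s = poly (pderiv f) (s::real)"
proof -
  have "(u has_real_derivative poly (pderiv f) s) (at s)"
    using has_field_derivative_transform_within_open[OF poly_DERIV, of "{a<..<b}" s f u] assms by auto
  then show ?thesis by (rule DERIV_imp_deriv)
qed

lemma integral_pderiv:
  fixes f :: "real poly"
  assumes "a \<le> b"
  shows "integral {a..b} (poly (pderiv f)) = poly f b - poly f a"
proof -
  have "(poly f has_vector_derivative poly (pderiv f) s) (at s within {a..b})" for s
    using has_field_derivative_at_within[OF poly_DERIV[of f s], of "{a..b}"]
    by (simp add: has_real_derivative_iff_has_vector_derivative)
  then show ?thesis
    using fundamental_theorem_of_calculus[OF assms] by (intro integral_unique) blast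
qed

lemma integral_by_parts_poly:
  fixes f g :: "real poly"
  assumes "a \<le> b"
  shows "integral {a..b} (\<lambda>s. poly (pderiv f) s * poly g s)
    = poly f b * poly g b - poly f a * poly g a - integral {a..b} (\<lambda>s. poly f s * poly (pderiv g) s)"
proof -
  have "integral {a..b} (\<lambda>s. poly (pderiv f) s * poly g s) + integral {a..b} (\<lambda>s. poly f s * poly (pderiv g) s)
      = integral {a..b} (\<lambda>s. poly (pderiv f) s * poly g s + poly f s * poly (pderiv g) s)"
    by (rule integral_add [symmetric]; rule integrable_continuous_interval; intro continuous_intros)
  also have "\<dots> = integral {a..b} (poly (pderiv (f * g)))"
    by (intro integral_cong) (simp add: pderiv_mult mult.commute add.commute)
  finally have "integral {a..b} (\<lambda>s. poly (pderiv f) s * poly g s)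
      + integral {a..b} (\<lambda>s. poly f s * poly (pderiv g) s) = integral {a..b} (poly (pderiv (f * g)))" .
  then show ?thesis using integral_pderiv[OF assms, of "f * g"] by simp
qed

lemma antiderivative_poly:
  fixes f :: "real poly"
  shows "\<exists>Q. pderiv Q = f \<and> degree Q \<le> Suc (degree f)"
proof (intro exI conjI)
  let ?Q = "\<Sum>k\<le>degree f. monom (coeff f k / real (Suc k)) (Suc k)"
  show "pderiv ?Q = f"
  proof (rule poly_eqI)
    fix n
    have "coeff (pderiv ?Q) n = real (Suc n) * (\<Sum>k\<le>degree f. if k = n then coeff f k / real (Suc k) else 0)"
      unfolding coeff_pderiv coeff_sum coeff_monom by (simp only: nat.inject of_nat_Suc)
    also have "\<dots> = coeff f n"
      by (simp add: coeff_eq_0)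
    finally show "coeff (pderiv ?Q) n = coeff f n" .
  qed
  show "degree ?Q \<le> Suc (degree f)"
    by (intro degree_sum_le) (auto intro: order_trans[OF degree_monom_le])
qed

section \<open>Energy estimates on one interval\<close>

text \<open>
  With \<open>m = max \<bar>g\<bar>\<close>, the inverse inequality gives \<open>(b - a)\<^sup>3 m\<^sup>2 \<le> C (b - a)\<^sup>2 m S\<close>, and one factor \<open>m\<close>
  cancels. The energy bound is required for every upper bound \<open>m\<close> of \<open>\<bar>g\<bar>\<close>, so that the maximum
  need not be named by the caller.
\<close>

lemma poly_bound_from_weighted_energy:
  fixes g :: "real poly"
  assumes "a < b" "degree g \<le> q" "0 \<le> S"
    and energy: "\<And>m. (\<And>s. s \<in> {a..b} \<Longrightarrow> \<bar>poly g s\<bar> \<le> m) \<Longrightarrow>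
      integral {a..b} (\<lambda>s. (s - a) * (b - s) * (poly g s)\<^sup>2) \<le> (b - a)\<^sup>2 * m * S"
    and "y \<in> {a..b}"
  shows "(b - a) * \<bar>poly g y\<bar> \<le> inverse_const q * S"
proof -
  have "\<exists>z\<in>{a..b}. \<forall>s\<in>{a..b}. \<bar>poly g s\<bar> \<le> \<bar>poly g z\<bar>"
    using \<open>a < b\<close> by (intro continuous_attains_sup) (auto intro!: continuous_intros)
  then obtain z where z: "z \<in> {a..b}" "\<And>s. s \<in> {a..b} \<Longrightarrow> \<bar>poly g s\<bar> \<le> \<bar>poly g z\<bar>" by blast
  define m where "m = \<bar>poly g z\<bar>"
  have m: "0 \<le> m" by (simp add: m_def)
  have c: "0 \<le> inverse_const q" using inverse_const_ge_1[of q] by simp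
  have "(b - a) ^ 3 * m\<^sup>2 \<le> inverse_const q * integral {a..b} (\<lambda>s. (s - a) * (b - s) * (poly g s)\<^sup>2)"
    using weighted_inverse_inequality[OF assms(2,1) z(1)] by (simp add: m_def)
  also have "\<dots> \<le> inverse_const q * ((b - a)\<^sup>2 * m * S)"
    using energy[of m] z(2) c unfolding m_def by (intro mult_left_mono) auto
  finally have *: "(b - a)\<^sup>2 * m * ((b - a) * m) \<le> (b - a)\<^sup>2 * m * (inverse_const q * S)"
    by (simp add: power2_eq_square power3_eq_cube mult_ac)
  have "(b - a) * m \<le> inverse_const q * S"
  proof (cases "m = 0")
    case True
    then show ?thesis using c assms(3) by simp
  next
    case False
    then have "0 < (b - a)\<^sup>2 * m" using m \<open>a < b\<close> by simp
    then show ?thesis using * by (rule mult_left_le_imp_le[rotated])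
  qed
  moreover have "(b - a) * \<bar>poly g y\<bar> \<le> (b - a) * m"
    using z(2)[OF assms(5)] \<open>a < b\<close> unfolding m_def by (intro mult_left_mono) auto
  ultimately show ?thesis by linarith
qed

lemma abs_integral_mult_le:
  fixes u r :: "real \<Rightarrow> real"
  assumes "bounded_measurable_on a b r" "continuous_on {a..b} u"
    "\<And>s. s \<in> {a..b} \<Longrightarrow> \<bar>u s\<bar> \<le> m"
  shows "\<bar>integral {a..b} (\<lambda>s. u s * r s)\<bar> \<le> m * integral {a..b} (\<lambda>s. \<bar>r s\<bar>)"
proof -
  have "norm (integral {a..b} (\<lambda>s. u s * r s)) \<le> integral {a..b} (\<lambda>s. m * \<bar>r s\<bar>)"
  proof (rule integral_norm_bound_integral)
    show "(\<lambda>s. u s * r s) integrable_on {a..b}"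
      by (intro bounded_measurable_on_integrable bounded_measurable_on_mult
          bounded_measurable_on_continuous assms)
    show "(\<lambda>s. m * \<bar>r s\<bar>) integrable_on {a..b}"
      by (intro integrable_on_mult_right bounded_measurable_on_integrable assms)
  qed (use assms(3) in \<open>auto simp: abs_mult intro!: mult_right_mono\<close>)
  then show ?thesis by simp
qed

lemma abs_integral_le:
  assumes "bounded_measurable_on a b r"
  shows "\<bar>integral {a..b} r\<bar> \<le> integral {a..b} (\<lambda>s. \<bar>r s\<bar>)"
  using abs_integral_mult_le[OF assms, of "\<lambda>_. 1" 1] by simp

lemma poly_variation_le:
  fixes f :: "real poly"
  assumes "\<And>y. y \<in> {a..b} \<Longrightarrow> (b - a) * \<bar>poly (pderiv f) y\<bar> \<le> K" "s \<in> {a..b}" "t \<in> {a..b}"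
  shows "\<bar>poly f s - poly f t\<bar> \<le> K"
proof -
  have *: "\<bar>poly f v - poly f u\<bar> \<le> K" if uv: "u < v" "u \<in> {a..b}" "v \<in> {a..b}" for u v
  proof -
    obtain x where x: "u < x" "x < v" "poly f v - poly f u = (v - u) * poly (pderiv f) x"
      using poly_MVT[OF uv(1)] by blast
    have "\<bar>poly f v - poly f u\<bar> = (v - u) * \<bar>poly (pderiv f) x\<bar>"
      using x uv by (simp add: abs_mult)
    also have "\<dots> \<le> (b - a) * \<bar>poly (pderiv f) x\<bar>"
      using uv by (intro mult_right_mono) auto
    also have "\<dots> \<le> K" using x uv by (intro assms(1)) auto
    finally show ?thesis .
  qed
  have "0 \<le> (b - a) * \<bar>poly (pderiv f) s\<bar>" using assms by simp
  then have "0 \<le> K" using assms(1)[OF assms(2)] by linarith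
  then show ?thesis
    using *[of s t] *[of t s] assms by (cases s t rule: linorder_cases) (auto simp: abs_minus_commute)
qed

text \<open>
  mcG tested with \<open>f'\<close>: \<open>\<integral> f'\<^sup>2 = - \<integral> f' r\<close> is at most \<open>max \<bar>f'\<bar> \<integral> \<bar>r\<bar>\<close>, so \<open>(b - a) max \<bar>f'\<bar>\<close> is at most a
  constant times \<open>\<integral> \<bar>r\<bar>\<close>.
\<close>

lemma continuous_method_local_bound:
  fixes f :: "real poly"
  assumes "a < b" "degree f \<le> q" and r: "bounded_measurable_on a b r"
    and eq: "integral {a..b} (\<lambda>s. poly (pderiv f) s * poly (pderiv f) s)
      = - integral {a..b} (\<lambda>s. poly (pderiv f) s * r s)"
    and "t \<in> {a..b}"
  shows "\<bar>poly f t - poly f a\<bar> \<le> inverse_const q * integral {a..b} (\<lambda>s. \<bar>r s\<bar>)"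
proof (rule poly_variation_le[of a b])
  let ?S = "integral {a..b} (\<lambda>s. \<bar>r s\<bar>)"
  fix y assume y: "y \<in> {a..b}"
  show "(b - a) * \<bar>poly (pderiv f) y\<bar> \<le> inverse_const q * ?S"
  proof (rule poly_bound_from_weighted_energy[OF \<open>a < b\<close> _ _ _ y])
    show "degree (pderiv f) \<le> q" using assms(2) by (simp add: degree_pderiv)
    show "0 \<le> ?S" by (intro integral_nonneg bounded_measurable_on_integrable r) auto
    fix m assume m: "\<And>s. s \<in> {a..b} \<Longrightarrow> \<bar>poly (pderiv f) s\<bar> \<le> m"
    have "integral {a..b} (\<lambda>s. (s - a) * (b - s) * (poly (pderiv f) s)\<^sup>2)
        \<le> integral {a..b} (\<lambda>s. (b - a)\<^sup>2 * (poly (pderiv f) s * poly (pderiv f) s))"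
      unfolding power2_eq_square
      by (intro integral_le integrable_continuous_interval continuous_intros mult_right_mono mult_mono) auto
    also have "\<dots> = (b - a)\<^sup>2 * integral {a..b} (\<lambda>s. poly (pderiv f) s * poly (pderiv f) s)"
      by simp
    also have "\<dots> \<le> (b - a)\<^sup>2 * (m * ?S)"
    proof (rule mult_left_mono)
      have "\<bar>integral {a..b} (\<lambda>s. poly (pderiv f) s * r s)\<bar> \<le> m * ?S"
        by (rule abs_integral_mult_le[OF r _ m]) (intro continuous_intros)
      then show "integral {a..b} (\<lambda>s. poly (pderiv f) s * poly (pderiv f) s) \<le> m * ?S"
        unfolding eq by linarith
    qed simp
    finally show "integral {a..b} (\<lambda>s. (s - a) * (b - s) * (poly (pderiv f) s)\<^sup>2)
        \<le> (b - a)\<^sup>2 * m * ?S" by simp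
  qed
qed (use assms in auto)

text \<open>
  mdG and mdG* tested with \<open>(s - c) f'\<close>, which vanishes at the end \<open>c\<close> of the interval where the
  method admits a jump and so removes the jump from the equation. The moduli make the statement
  insensitive to the sign, which depends on the direction of time.
\<close>

lemma discontinuous_method_local_bound:
  fixes f :: "real poly"
  assumes "a < b" "degree f \<le> q" and r: "bounded_measurable_on a b r"
    and c: "c \<in> {a, b}"
    and eq: "\<bar>integral {a..b} (\<lambda>s. (s - c) * poly (pderiv f) s * poly (pderiv f) s)\<bar>
      = \<bar>integral {a..b} (\<lambda>s. (s - c) * poly (pderiv f) s * r s)\<bar>"
    and "s \<in> {a..b}" "t \<in> {a..b}"
  shows "\<bar>poly f s - poly f t\<bar> \<le> inverse_const q * integral {a..b} (\<lambda>s. \<bar>r s\<bar>)"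
proof (rule poly_variation_le[of a b])
  let ?S = "integral {a..b} (\<lambda>s. \<bar>r s\<bar>)"
  fix y assume y: "y \<in> {a..b}"
  show "(b - a) * \<bar>poly (pderiv f) y\<bar> \<le> inverse_const q * ?S"
  proof (rule poly_bound_from_weighted_energy[OF \<open>a < b\<close> _ _ _ y])
    show "degree (pderiv f) \<le> q" using assms(2) by (simp add: degree_pderiv)
    show "0 \<le> ?S" by (intro integral_nonneg bounded_measurable_on_integrable r) auto
    fix m assume m: "\<And>s. s \<in> {a..b} \<Longrightarrow> \<bar>poly (pderiv f) s\<bar> \<le> m"
    \<comment> \<open>the sign that makes the weight nonnegative\<close>
    define \<sigma> :: real where "\<sigma> = (if c = a then 1 else - 1)"
    have \<sigma>: "\<bar>\<sigma>\<bar> = 1" by (simp add: \<sigma>_def)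
    have w: "(s - a) * (b - s) \<le> (b - a) * \<sigma> * (s - c)" if "s \<in> {a..b}" for s
    proof -
      have "(s - a) * (b - s) \<le> (b - a) * (s - a)" "(s - a) * (b - s) \<le> (b - a) * (b - s)"
        using that mult_right_mono[of "b - s" "b - a" "s - a"] mult_right_mono[of "s - a" "b - a" "b - s"]
        by (auto simp: mult.commute)
      then show ?thesis using c by (auto simp: \<sigma>_def algebra_simps)
    qed
    have bnd: "\<bar>integral {a..b} (\<lambda>s. (s - c) * poly (pderiv f) s * r s)\<bar> \<le> ((b - a) * m) * ?S"
    proof (rule abs_integral_mult_le[OF r])
      show "\<bar>(s - c) * poly (pderiv f) s\<bar> \<le> (b - a) * m" if "s \<in> {a..b}" for s
        unfolding abs_mult using that c m[OF that] by (intro mult_mono) auto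
    qed (intro continuous_intros)
    have "integral {a..b} (\<lambda>s. (s - a) * (b - s) * (poly (pderiv f) s)\<^sup>2)
        \<le> integral {a..b} (\<lambda>s. (b - a) * \<sigma> * (s - c) * (poly (pderiv f) s)\<^sup>2)"
      by (intro integral_le integrable_continuous_interval continuous_intros mult_right_mono w) auto
    also have "\<dots> = integral {a..b} (\<lambda>s. (b - a) * \<sigma> * ((s - c) * poly (pderiv f) s * poly (pderiv f) s))"
      by (simp add: power2_eq_square mult_ac)
    also have "\<dots> = (b - a) * \<sigma> * integral {a..b} (\<lambda>s. (s - c) * poly (pderiv f) s * poly (pderiv f) s)"
      by (rule integral_mult_right)
    also have "\<dots> \<le> \<bar>(b - a) * \<sigma> * integral {a..b} (\<lambda>s. (s - c) * poly (pderiv f) s * poly (pderiv f) s)\<bar>"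
      by (rule abs_ge_self)
    also have "\<dots> = (b - a) * \<bar>integral {a..b} (\<lambda>s. (s - c) * poly (pderiv f) s * r s)\<bar>"
      unfolding abs_mult eq using \<open>a < b\<close> \<sigma> by simp
    also have "\<dots> \<le> (b - a) * (((b - a) * m) * ?S)"
      using bnd \<open>a < b\<close> by (intro mult_left_mono) auto
    finally show "integral {a..b} (\<lambda>s. (s - a) * (b - s) * (poly (pderiv f) s)\<^sup>2)
        \<le> (b - a)\<^sup>2 * m * ?S" by (simp add: power2_eq_square)
  qed
qed (use assms in auto)

text \<open>
  mcG* tested with an antiderivative \<open>Q\<close> of \<open>g = f - F\<close> that vanishes at \<open>a\<close>: as \<open>Q(b) = \<integral> g\<close>, the
  equation becomes \<open>\<integral> g\<^sup>2 = - \<integral> Q r\<close>, and \<open>\<bar>Q\<bar> \<le> (b - a) max \<bar>g\<bar>\<close>. Hence \<open>g\<close> itself, instead of a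
  derivative, is bounded; this is why \<open>S\<close> is replaced by \<open>(b - a) S\<close> in the energy lemma.
\<close>

lemma dual_continuous_method_local_bound:
  fixes f :: "real poly"
  assumes "a < b" "degree f \<le> q" and r: "bounded_measurable_on a b r"
    and eq: "\<And>Q. poly Q a = 0 \<Longrightarrow> degree Q \<le> Suc (degree f) \<Longrightarrow>
      integral {a..b} (\<lambda>s. poly (pderiv Q) s * poly f s)
      = poly Q b * F - integral {a..b} (\<lambda>s. poly Q s * r s)"
    and t: "t \<in> {a..b}"
  shows "\<bar>poly f t - F\<bar> \<le> inverse_const q * integral {a..b} (\<lambda>s. \<bar>r s\<bar>)"
proof -
  let ?S = "integral {a..b} (\<lambda>s. \<bar>r s\<bar>)"
  define g where "g = f - [:F:]"
  have dg: "degree g \<le> degree f" unfolding g_def by (intro degree_diff_le) auto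
  obtain Q0 where Q0: "pderiv Q0 = g" "degree Q0 \<le> Suc (degree g)"
    using antiderivative_poly by blast
  define Q where "Q = Q0 - [:poly Q0 a:]"
  have Q: "pderiv Q = g" "poly Q a = 0" "degree Q \<le> Suc (degree f)"
    unfolding Q_def using Q0 dg by (auto simp: pderiv_diff pderiv_pCons intro!: degree_diff_le)
  have S: "0 \<le> ?S" by (intro integral_nonneg bounded_measurable_on_integrable r) auto
  have "integral {a..b} (poly g) = poly Q b"
    using integral_pderiv[of a b Q] Q \<open>a < b\<close> by simp
  moreover have "integral {a..b} (\<lambda>s. poly g s * poly f s)
      = integral {a..b} (\<lambda>s. poly g s * poly g s) + integral {a..b} (\<lambda>s. poly g s * F)"
    by (subst integral_add [symmetric])
      (auto simp: g_def algebra_simps intro!: integrable_continuous_interval continuous_intros)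
  ultimately have gg: "integral {a..b} (\<lambda>s. poly g s * poly g s) = - integral {a..b} (\<lambda>s. poly Q s * r s)"
    using eq[OF Q(2,3)] Q(1) by simp
  have "(b - a) * \<bar>poly g t\<bar> \<le> inverse_const q * ((b - a) * ?S)"
  proof (rule poly_bound_from_weighted_energy[OF \<open>a < b\<close> _ _ _ t])
    show "degree g \<le> q" using dg assms(2) by simp
    show "0 \<le> (b - a) * ?S" using S \<open>a < b\<close> by simp
    fix m assume m: "\<And>s. s \<in> {a..b} \<Longrightarrow> \<bar>poly g s\<bar> \<le> m"
    have "\<bar>poly Q s\<bar> \<le> (b - a) * m" if "s \<in> {a..b}" for s
      using poly_variation_le[of a b Q "(b - a) * m" s a] that m \<open>a < b\<close> Q by (auto simp: mult_left_mono)
    then have "\<bar>integral {a..b} (\<lambda>s. poly Q s * r s)\<bar> \<le> (b - a) * m * ?S"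
      by (intro abs_integral_mult_le r) (auto intro!: continuous_intros)
    then have e: "integral {a..b} (\<lambda>s. poly g s * poly g s) \<le> (b - a) * m * ?S" using gg by linarith
    have "integral {a..b} (\<lambda>s. (s - a) * (b - s) * (poly g s)\<^sup>2)
        \<le> integral {a..b} (\<lambda>s. (b - a)\<^sup>2 * (poly g s * poly g s))"
      unfolding power2_eq_square
      by (intro integral_le integrable_continuous_interval continuous_intros mult_right_mono mult_mono) auto
    also have "\<dots> = (b - a)\<^sup>2 * integral {a..b} (\<lambda>s. poly g s * poly g s)" by simp
    also have "\<dots> \<le> (b - a)\<^sup>2 * ((b - a) * m * ?S)" using e by (intro mult_left_mono) auto
    finally show "integral {a..b} (\<lambda>s. (s - a) * (b - s) * (poly g s)\<^sup>2)
        \<le> (b - a)\<^sup>2 * m * ((b - a) * ?S)" by (simp add: mult_ac)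
  qed
  then have "(b - a) * \<bar>poly g t\<bar> \<le> (b - a) * (inverse_const q * ?S)" by (simp add: mult_ac)
  then have "\<bar>poly g t\<bar> \<le> inverse_const q * ?S" using \<open>a < b\<close> by (simp add: mult_le_cancel_left_pos)
  then show ?thesis by (simp add: g_def)
qed

section \<open>Pieces of a discrete solution and test functions on one interval\<close>

lemma integral_mirror:
  fixes g :: "real \<Rightarrow> real"
  shows "integral {a..b} (\<lambda>s. g (c - s)) = integral {c - b..c - a} g"
proof -
  have "integral {a..b} (\<lambda>s. g (c - s)) = integral {- b..- a} (\<lambda>s. g (s + c))"
    using Henstock_Kurzweil_Integration.integral_reflect_real[of b a "\<lambda>s. g (c - s)"]
    by (simp add: add.commute)
  also have "\<dots> = integral {c - b..c - a} g"
    using integral_shift_real_ivl[of "c - b" c "c - a" g] by simp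
  finally show ?thesis .
qed

lemma integrable_mirror:
  fixes g :: "real \<Rightarrow> real"
  assumes "g integrable_on {c - b..c - a}"
  shows "(\<lambda>s. g (c - s)) integrable_on {a..b}"
proof -
  have "(\<lambda>s. g (s + c)) integrable_on {- b..- a}"
    using has_integral_shift_real_ivl[OF integrable_integral[OF assms], of c]
    by (auto simp: integrable_on_def)
  then show ?thesis
    using Henstock_Kurzweil_Integration.integrable_reflect_real[of "\<lambda>s. g (c - s)" b a]
    by (simp add: add.commute)
qed

lemma bounded_measurable_on_mirror:
  assumes "bounded_measurable_on 0 c g"
  shows "bounded_measurable_on 0 c (\<lambda>s. g (c - s))"
proof -
  obtain K where K: "\<forall>s\<in>{0..c}. \<bar>g s\<bar> \<le> K" using assms by (rule bounded_measurable_onE)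
  have "(\<lambda>s. g (c - s)) integrable_on {0..c}"
    using bounded_measurable_on_integrable(1)[OF assms] by (intro integrable_mirror) simp
  then show ?thesis
    using K by (intro bounded_measurable_onI[of _ _ _ K] integrable_imp_measurable) auto
qed

lemma grid_accumulate:
  assumes "grid x n" "r integrable_on {x 0..x n}" "l \<le> n"
    "\<And>j. j \<in> {1..n} \<Longrightarrow> v j = v (j - 1) - integral {x (j - 1)..x j} r"
  shows "v l = v 0 - integral {x 0..x l} (r :: real \<Rightarrow> real)"
  using \<open>l \<le> n\<close>
proof (induction l)
  case (Suc l)
  have le: "x 0 \<le> x l" "x l \<le> x (Suc l)" "x (Suc l) \<le> x n"
    using Suc.prems by (auto intro!: grid_le[OF assms(1)])
  then have "r integrable_on {x 0..x (Suc l)}"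
    by (intro integrable_on_subinterval[OF assms(2)]) auto
  then have "integral {x 0..x l} r + integral {x l..x (Suc l)} r = integral {x 0..x (Suc l)} r"
    using le by (intro Henstock_Kurzweil_Integration.integral_combine) auto
  then show ?case using Suc assms(4)[of "Suc l"] by simp
qed simp

text \<open>
  The counterpart for the dual methods, whose data are prescribed at the final time.
\<close>

lemma grid_accumulate_backwards:
  assumes "grid x n" "r integrable_on {x 0..x n}" "l \<le> n"
    "\<And>j. j \<in> {1..n} \<Longrightarrow> v (j - 1) = v j - integral {x (j - 1)..x j} r"
  shows "v l = v n - integral {x l..x n} (r :: real \<Rightarrow> real)"
proof -
  have *: "v k = v 0 - integral {x 0..x k} (\<lambda>s. - r s)" if "k \<le> n" for k
  proof (rule grid_accumulate[OF assms(1) _ that])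
    show "(\<lambda>s. - r s) integrable_on {x 0..x n}" using assms(2) by (rule integrable_neg)
    show "v j = v (j - 1) - integral {x (j - 1)..x j} (\<lambda>s. - r s)" if "j \<in> {1..n}" for j
      using assms(4)[OF that] by simp
  qed
  have "integral {x 0..x l} r + integral {x l..x n} r = integral {x 0..x n} r"
    using assms(3) by (intro Henstock_Kurzweil_Integration.integral_combine assms(2) grid_le[OF assms(1)]) auto
  then show ?thesis using *[OF assms(3)] *[of n] by simp
qed

lemma valid_partition_grid:
  assumes "valid_partition P" "i < ncomp P"
  shows "grid (node P i) (npieces P i)" "1 \<le> npieces P i" "node P i 0 = 0"
    "node P i (npieces P i) = horizon P"
  using assms by (auto simp: valid_partition_def grid_def)

lemma valid_partition_cell:
  assumes "valid_partition P" "i < ncomp P" "j \<in> {1..npieces P i}"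
  shows "0 \<le> node P i (j - 1)" "node P i (j - 1) < node P i j" "node P i j \<le> horizon P"
  using valid_partition_grid[OF assms(1,2)] assms(3)
    grid_le[of "node P i" "npieces P i" 0 "j - 1"] grid_le[of "node P i" "npieces P i" j "npieces P i"]
  by (auto simp: grid_def)

text \<open>
  Solutions of mcG and mdG, and the functions \<open>\<Phi>\<close> of the dual methods, are polynomial on left-open
  intervals; reversing time turns these into right-open ones. The value at the end point of
  \<open>[0, T]\<close> not covered by the intervals is that of the adjacent polynomial.
\<close>

definition left_pieces :: "partition \<Rightarrow> (nat \<Rightarrow> nat \<Rightarrow> real poly) \<Rightarrow> (real \<Rightarrow> nat \<Rightarrow> real) \<Rightarrow> bool" where
  "left_pieces P f W \<longleftrightarrow>
     (\<forall>i<ncomp P. W 0 i = poly (f i 1) 0 \<and>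
        (\<forall>j\<in>{1..npieces P i}. \<forall>s\<in>{node P i (j - 1)<..node P i j}. W s i = poly (f i j) s))"

definition right_pieces :: "partition \<Rightarrow> (nat \<Rightarrow> nat \<Rightarrow> real poly) \<Rightarrow> (real \<Rightarrow> nat \<Rightarrow> real) \<Rightarrow> bool" where
  "right_pieces P f W \<longleftrightarrow>
     (\<forall>i<ncomp P. W (horizon P) i = poly (f i (npieces P i)) (horizon P) \<and>
        (\<forall>j\<in>{1..npieces P i}. \<forall>s\<in>{node P i (j - 1)..<node P i j}. W s i = poly (f i j) s))"

lemma broken_space_left_pieces:
  assumes "valid_partition P" "v \<in> broken_space P d"
  obtains f where "left_pieces P f v"
    "\<And>i j. i < ncomp P \<Longrightarrow> j \<in> {1..npieces P i} \<Longrightarrow> degree (f i j) \<le> d i j"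
proof -
  have "\<exists>f. i < ncomp P \<longrightarrow> j \<in> {1..npieces P i} \<longrightarrow> degree f \<le> d i j \<and>
      (\<forall>s\<in>{node P i (j - 1)<..node P i j}. v s i = poly f s)" for i j
    using assms(2) unfolding broken_space_def by blast
  then obtain f where f: "\<And>i j. i < ncomp P \<Longrightarrow> j \<in> {1..npieces P i} \<Longrightarrow> degree (f i j) \<le> d i j \<and>
      (\<forall>s\<in>{node P i (j - 1)<..node P i j}. v s i = poly (f i j) s)" by metis
  have "v 0 i = poly (f i 1) 0" if i: "i < ncomp P" for i
  proof -
    note g = valid_partition_grid[OF assms(1) i] valid_partition_cell[OF assms(1) i, of 1]
    have "((\<lambda>s. v s i) \<longlongrightarrow> poly (f i 1) 0) (at_right 0)"
      using f[OF i, of 1] g by (intro tendsto_at_right_poly[of _ "node P i 1"]) auto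
    moreover have "((\<lambda>s. v s i) \<longlongrightarrow> v 0 i) (at_right 0)"
      using assms(2) i unfolding broken_space_def by blast
    ultimately show ?thesis using tendsto_unique[of "at_right (0::real)"] by force
  qed
  then show thesis using f by (intro that[of f]) (auto simp: left_pieces_def)
qed

lemma left_pieces_bounded_measurable:
  assumes "valid_partition P" "left_pieces P f W" "i < ncomp P"
  shows "bounded_measurable_on 0 (horizon P) (\<lambda>s. W s i)"
  using bounded_measurable_on_piecewise_poly[of "node P i" "npieces P i" "\<lambda>s. W s i" "f i"]
    valid_partition_grid[OF assms(1,3)] assms(2,3) by (auto simp: left_pieces_def)

lemma right_pieces_bounded_measurable:
  assumes "valid_partition P" "right_pieces P f W" "i < ncomp P"
  shows "bounded_measurable_on 0 (horizon P) (\<lambda>s. W s i)"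
  using bounded_measurable_on_piecewise_poly[of "node P i" "npieces P i" "\<lambda>s. W s i" "f i"]
    valid_partition_grid[OF assms(1,3)] assms(2,3) by (auto simp: right_pieces_def)

lemma mat_vec_bounded_measurable:
  assumes "bounded_measurable_matrix N T B" "\<And>k. k < N \<Longrightarrow> bounded_measurable_on 0 T (\<lambda>s. W s k)" "i < N"
  shows "bounded_measurable_on 0 T (\<lambda>s. mat_vec N (B s) (W s) i)"
  unfolding mat_vec_def
proof (intro bounded_measurable_on_sum bounded_measurable_on_mult)
  fix k assume "k \<in> {..<N}"
  then show "bounded_measurable_on 0 T (\<lambda>s. W s k)" "bounded_measurable_on 0 T (\<lambda>s. B s i k)"
    using assms by (auto simp: bounded_measurable_on_def bounded_measurable_matrix_def)
qed

locale partition_cell =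
  fixes P :: partition and i j :: nat
  assumes valid: "valid_partition P" and i: "i < ncomp P" and j: "j \<in> {1..npieces P i}"
begin

abbreviation a where "a \<equiv> node P i (j - 1)"
abbreviation b where "b \<equiv> node P i j"
abbreviation T where "T \<equiv> horizon P"

lemmas gr = valid_partition_grid[OF valid i]
lemmas cell = valid_partition_cell[OF valid i j]

text \<open>
  The condition \<open>a = 0 \<and> s = 0\<close> supplies the value at time 0 that membership in the broken space
  prescribes. For negative times the function is zero, as the dual method asks of its test
  functions.
\<close>

definition bump :: "real poly \<Rightarrow> real \<Rightarrow> real" where
  "bump p s = (if a < s \<and> s \<le> b \<or> a = 0 \<and> s = 0 then poly p s else 0)"

definition test :: "real poly \<Rightarrow> real \<Rightarrow> nat \<Rightarrow> real" where
  "test p s k = (if k = i then bump p s else 0)"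

lemma bump_piece:
  assumes "l \<in> {1..npieces P i}" "s \<in> {node P i (l - 1)<..node P i l}"
  shows "bump p s = poly (if l = j then p else 0) s"
proof (cases "l = j")
  case True
  then show ?thesis using assms by (simp add: bump_def)
next
  case False
  have "s \<notin> {a<..b}" by (rule grid_pieces_disjoint[OF gr(1) j assms(1) False assms(2)])
  moreover have "s > 0" using valid_partition_cell(1)[OF valid i assms(1)] assms(2) by auto
  ultimately show ?thesis using False by (auto simp: bump_def)
qed

lemma bump_right_limit:
  assumes "l \<in> {1..npieces P i}"
  shows "(bump p \<longlongrightarrow> (if l = j then poly p a else 0)) (at_right (node P i (l - 1)))"
proof -
  have "(bump p \<longlongrightarrow> poly (if l = j then p else 0) (node P i (l - 1))) (at_right (node P i (l - 1)))"
    using bump_piece[OF assms] by (intro tendsto_at_right_poly[OF valid_partition_cell(2)[OF valid i assms]]) auto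
  then show ?thesis by (cases "l = j") auto
qed

lemma bump_left_limit:
  assumes "l \<in> {1..npieces P i}"
  shows "(bump p \<longlongrightarrow> (if l = Suc j then poly p b else 0)) (at_left (node P i (l - 1)))"
proof (cases "l = 1")
  case True
  have "(bump p \<longlongrightarrow> poly 0 0) (at_left 0)"
    using cell by (intro tendsto_at_left_poly[of "-1"]) (auto simp: bump_def)
  then show ?thesis using True gr(3) j by simp
next
  case False
  then have l: "l - 1 \<in> {1..npieces P i}" using assms by auto
  have "(bump p \<longlongrightarrow> poly (if l - 1 = j then p else 0) (node P i (l - 1))) (at_left (node P i (l - 1)))"
    using bump_piece[OF l] by (intro tendsto_at_left_poly[OF valid_partition_cell(2)[OF valid i l]]) auto
  moreover have "l - 1 = j \<longleftrightarrow> l = Suc j" using False assms by auto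
  ultimately show ?thesis by (cases "l = Suc j") auto
qed

lemma bump_outside: "s \<in> {0..T} - {a..b} \<Longrightarrow> bump p s = 0"
  using cell by (auto simp: bump_def)

lemma bump_inside: "s \<in> {a<..<b} \<Longrightarrow> bump p s = poly p s"
  by (auto simp: bump_def)

lemma test_in_broken_space:
  assumes "degree p \<le> d i j"
  shows "test p \<in> broken_space P d"
  unfolding broken_space_def
proof (intro CollectI allI impI conjI ballI)
  fix k assume k: "k < ncomp P"
  show "((\<lambda>s. test p s k) \<longlongrightarrow> test p 0 k) (at_right 0)"
  proof (cases "k = i")
    case True
    have "a = 0 \<longleftrightarrow> j = 1"
      using grid_less[OF gr(1), of 0 "j - 1"] gr(3) j by force
    then have "bump p 0 = (if 1 = j then poly p a else 0)"
      using cell by (auto simp: bump_def)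
    then show ?thesis using bump_right_limit[of 1 p] gr True by (simp add: test_def)
  qed (simp add: test_def)
  fix l assume l: "l \<in> {1..npieces P k}"
  show "\<exists>f. degree f \<le> d k l \<and> (\<forall>s\<in>{node P k (l - 1)<..node P k l}. test p s k = poly f s)"
    using l assms bump_piece[of l]
    by (intro exI[of _ "if k = i \<and> l = j then p else 0"]) (auto simp: test_def)
qed

lemma integral_ip_test:
  "integral {0..T} (\<lambda>s. ip (ncomp P) (X s) (test p s)) = integral {a..b} (\<lambda>s. poly p s * X s i)"
proof (rule integral_localize)
  have eq: "ip (ncomp P) (X s) (test p s) = bump p s * X s i" for s
    using i by (simp add: ip_def test_def if_distrib mult.commute cong: if_cong)
  show "{a..b} \<subseteq> {0..T}" using cell by auto
  show "ip (ncomp P) (X s) (test p s) = poly p s * X s i" if "s \<in> {a<..<b}" for s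
    using that by (simp add: eq bump_inside)
  show "ip (ncomp P) (X s) (test p s) = 0" if "s \<in> {0..T} - {a..b}" for s
    using bump_outside[OF that] by (simp add: eq)
qed

text \<open>
  Only the term of the interval under consideration survives, because a test function in the second
  argument enters through its limits from the right.
\<close>

lemma mdG_form_test_right:
  assumes "left_pieces P f W"
  shows "mdG_form P W (test p) = jump (\<lambda>s. W s i) a * poly p a
    + integral {a..b} (\<lambda>s. poly (pderiv (f i j)) s * poly p s)" (is "_ = ?X")
proof -
  have "jump (\<lambda>s. W s k) (node P k (l - 1)) * right_lim (\<lambda>s. test p s k) (node P k (l - 1)) +
      integral {node P k (l - 1)..node P k l} (\<lambda>s. dt W s k * test p s k)
      = (if k = i then if l = j then ?X else 0 else 0)" (is "?L = _")
    if "k < ncomp P" "l \<in> {1..npieces P k}" for k l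
  proof (cases "k = i")
    case False
    then show ?thesis by (simp add: test_def right_lim_eq)
  next
    case True
    note l = that(2)[unfolded True]
    have r: "right_lim (bump p) (node P i (l - 1)) = (if l = j then poly p a else 0)"
      by (rule right_lim_eq[OF bump_right_limit[OF l]])
    have "integral {node P i (l - 1)..node P i l} (\<lambda>s. dt W s i * bump p s)
        = integral {node P i (l - 1)..node P i l} (\<lambda>s. poly (pderiv (f i l)) s * poly (if l = j then p else 0) s)"
    proof (rule integral_localize[OF order_refl])
      fix s assume s: "s \<in> {node P i (l - 1)<..<node P i l}"
      have "dt W s i = poly (pderiv (f i l)) s" unfolding dt_def
        using assms i l s by (intro deriv_eq_poly_pderiv[of "node P i (l - 1)" "node P i l"])
          (auto simp: left_pieces_def)
      then show "dt W s i * bump p s = poly (pderiv (f i l)) s * poly (if l = j then p else 0) s"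
        using bump_piece[OF l, of s] s by auto
    qed simp
    then show ?thesis using True r by (simp add: test_def)
  qed
  then have "mdG_form P W (test p)
      = (\<Sum>k<ncomp P. \<Sum>l=1..npieces P k. if k = i then if l = j then ?X else 0 else 0)"
    unfolding mdG_form_def by (intro sum.cong) auto
  also have "\<dots> = (\<Sum>k<ncomp P. if k = i then \<Sum>l=1..npieces P k. if l = j then ?X else 0 else 0)"
    by (intro sum.cong) auto
  also have "\<dots> = ?X" using i j by (simp add: sum.delta)
  finally show ?thesis .
qed

text \<open>
  In the first argument the test function contributes two jumps, at \<open>a\<close> and at \<open>b\<close>. The second one
  pairs with the next piece; at the final time it is missing, and the terminal datum takes its
  place.
\<close>

lemma mdG_form_test_left:
  assumes "left_pieces P f \<Phi>"
  shows "mdG_form P (test p) \<Phi> = poly p a * poly (f i j) a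
    - (if j = npieces P i then 0 else poly p b * poly (f i (Suc j)) b)
    + integral {a..b} (\<lambda>s. poly (pderiv p) s * poly (f i j) s)" (is "_ = ?X - ?Y + ?Z")
proof -
  have "jump (\<lambda>s. test p s k) (node P k (l - 1)) * right_lim (\<lambda>s. \<Phi> s k) (node P k (l - 1)) +
      integral {node P k (l - 1)..node P k l} (\<lambda>s. dt (test p) s k * \<Phi> s k)
      = (if k = i then (if l = j then ?X + ?Z else 0) - (if l = Suc j then ?Y else 0) else 0)" (is "?L = _")
    if "k < ncomp P" "l \<in> {1..npieces P k}" for k l
  proof (cases "k = i")
    case False
    have "jump (\<lambda>s. 0) x = 0" for x
      unfolding jump_def by (simp add: right_lim_eq[OF tendsto_const] left_lim_eq[OF tendsto_const])
    with False show ?thesis by (simp add: test_def dt_def)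
  next
    case True
    note l = that(2)[unfolded True]
    have ju: "jump (bump p) (node P i (l - 1))
        = (if l = j then poly p a else 0) - (if l = Suc j then poly p b else 0)"
      unfolding jump_def right_lim_eq[OF bump_right_limit[OF l]] left_lim_eq[OF bump_left_limit[OF l]] ..
    have r: "right_lim (\<lambda>s. \<Phi> s i) (node P i (l - 1)) = poly (f i l) (node P i (l - 1))"
      using assms i l by (intro right_lim_eq
          tendsto_at_right_poly[OF valid_partition_cell(2)[OF valid i l]]) (auto simp: left_pieces_def)
    have "integral {node P i (l - 1)..node P i l} (\<lambda>s. dt (test p) s i * \<Phi> s i)
        = integral {node P i (l - 1)..node P i l} (\<lambda>s. poly (pderiv (if l = j then p else 0)) s * poly (f i l) s)"
    proof (rule integral_localize[OF order_refl])
      fix s assume s: "s \<in> {node P i (l - 1)<..<node P i l}"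
      have "dt (test p) s i = poly (pderiv (if l = j then p else 0)) s" unfolding dt_def
        using bump_piece[OF l] s by (intro deriv_eq_poly_pderiv[of "node P i (l - 1)" "node P i l"])
          (auto simp: test_def)
      then show "dt (test p) s i * \<Phi> s i = poly (pderiv (if l = j then p else 0)) s * poly (f i l) s"
        using assms i l s by (auto simp: left_pieces_def)
    qed simp
    then show ?thesis using True r ju l by (auto simp: test_def)
  qed
  then have "mdG_form P (test p) \<Phi> = (\<Sum>k<ncomp P. \<Sum>l=1..npieces P k.
      if k = i then (if l = j then ?X + ?Z else 0) - (if l = Suc j then ?Y else 0) else 0)"
    unfolding mdG_form_def by (intro sum.cong) auto
  also have "\<dots> = (\<Sum>k<ncomp P. if k = i then \<Sum>l=1..npieces P k.
      (if l = j then ?X + ?Z else 0) - (if l = Suc j then ?Y else 0) else 0)"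
    by (intro sum.cong) auto
  also have "\<dots> = (\<Sum>l=1..npieces P i. (if l = j then ?X + ?Z else 0) - (if l = Suc j then ?Y else 0))"
    using i by (simp add: sum.delta)
  also have "\<dots> = ?X + ?Z - ?Y"
    using j by (auto simp: sum_subtractf sum.delta)
  finally show ?thesis by simp
qed

text \<open>
  If \<open>Q\<close> vanishes at \<open>a\<close>, this is zero before the interval and constant after it: the
  continuous function whose derivative is \<open>Q'\<close> restricted to the interval.
\<close>

definition ramp :: "real poly \<Rightarrow> real \<Rightarrow> real" where
  "ramp Q s = poly Q (max a (min b s))"

definition ramp_test :: "real poly \<Rightarrow> real \<Rightarrow> nat \<Rightarrow> real" where
  "ramp_test Q s k = (if k = i then ramp Q s else 0)"

lemma continuous_on_ramp: "continuous_on S (ramp Q)"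
  unfolding ramp_def by (intro continuous_intros)

lemma ramp_test_in_mcG_V:
  assumes "degree Q \<le> qdeg P i j"
  shows "ramp_test Q \<in> mcG_V P"
  unfolding mcG_V_def broken_space_def
proof (intro CollectI allI impI conjI ballI)
  fix k assume k: "k < ncomp P"
  show "continuous_on {0..T} (\<lambda>s. ramp_test Q s k)"
    using continuous_on_ramp by (cases "k = i") (auto simp: ramp_test_def)
  have "isCont (ramp Q) 0"
    using continuous_on_ramp[of UNIV] by (simp add: continuous_on_eq_continuous_at)
  then show "((\<lambda>s. ramp_test Q s k) \<longlongrightarrow> ramp_test Q 0 k) (at_right 0)"
    by (cases "k = i") (auto simp: ramp_test_def isCont_def intro: tendsto_within_subset)
  fix l assume l: "l \<in> {1..npieces P k}"
  show "\<exists>f. degree f \<le> qdeg P k l \<and> (\<forall>s\<in>{node P k (l - 1)<..node P k l}. ramp_test Q s k = poly f s)"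
  proof (cases "k = i \<and> l = j")
    case True
    then show ?thesis using assms by (intro exI[of _ Q]) (auto simp: ramp_test_def ramp_def)
  next
    case False
    consider "k \<noteq> i" | "k = i" "l < j" | "k = i" "l > j" using False by fastforce
    then show ?thesis
    proof cases
      case 1
      then show ?thesis by (intro exI[of _ 0]) (auto simp: ramp_test_def)
    next
      case 2
      then have "node P i l \<le> a" using j by (intro grid_le[OF gr(1)]) auto
      then show ?thesis using 2 cell
        by (intro exI[of _ "[:poly Q a:]"]) (auto simp: ramp_test_def ramp_def)
    next
      case 3
      then have "b \<le> node P i (l - 1)" using l by (intro grid_le[OF gr(1)]) auto
      then show ?thesis using 3 cell
        by (intro exI[of _ "[:poly Q b:]"]) (auto simp: ramp_test_def ramp_def)
    qed
  qed
qed

lemma integral_dt_ramp_test: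
  "integral {0..T} (\<lambda>s. ip (ncomp P) (dt (ramp_test Q) s) (X s))
    = integral {a..b} (\<lambda>s. poly (pderiv Q) s * X s i)"
proof (rule integral_localize)
  have d: "dt (ramp_test Q) s k = (if k = i then deriv (ramp Q) s else 0)" for s k
    by (cases "k = i") (auto simp: dt_def ramp_test_def)
  have eq: "ip (ncomp P) (dt (ramp_test Q) s) (X s) = deriv (ramp Q) s * X s i" for s
    using i by (simp add: ip_def d if_distrib if_distribR cong: if_cong)
  show "{a..b} \<subseteq> {0..T}" using cell by auto
  show "ip (ncomp P) (dt (ramp_test Q) s) (X s) = poly (pderiv Q) s * X s i" if "s \<in> {a<..<b}" for s
    using deriv_eq_poly_pderiv[of a b "ramp Q" Q s] that by (simp add: eq ramp_def)
  show "ip (ncomp P) (dt (ramp_test Q) s) (X s) = 0" if s: "s \<in> {0..T} - {a..b}" for s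
  proof -
    consider "s < a" | "b < s" using s by force
    then have "deriv (ramp Q) s = 0"
    proof cases
      case 1
      then show ?thesis using cell deriv_eq_poly_pderiv[of "s - 1" a "ramp Q" "[:poly Q a:]" s]
        by (auto simp: ramp_def pderiv_pCons)
    next
      case 2
      then show ?thesis using cell deriv_eq_poly_pderiv[of b "s + 1" "ramp Q" "[:poly Q b:]" s]
        by (auto simp: ramp_def pderiv_pCons)
    qed
    then show ?thesis by (simp add: eq)
  qed
qed

lemma integral_ramp_mult:
  assumes "bounded_measurable_on 0 T r" "poly Q a = 0"
  shows "integral {0..T} (\<lambda>s. ramp Q s * r s)
    = integral {a..b} (\<lambda>s. poly Q s * r s) + poly Q b * integral {b..T} r"
proof -
  have bm: "(\<lambda>s. ramp Q s * r s) integrable_on {c..d}" if "{c..d} \<subseteq> {0..T}" for c d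
    by (intro bounded_measurable_on_integrable bounded_measurable_on_subinterval[OF _ that]
        bounded_measurable_on_mult bounded_measurable_on_continuous continuous_on_ramp assms)
  have "integral {0..T} (\<lambda>s. ramp Q s * r s)
      = integral {0..b} (\<lambda>s. ramp Q s * r s) + integral {b..T} (\<lambda>s. ramp Q s * r s)"
    using cell by (intro Henstock_Kurzweil_Integration.integral_combine [symmetric] bm) auto
  also have "integral {0..b} (\<lambda>s. ramp Q s * r s) = integral {a..b} (\<lambda>s. poly Q s * r s)"
    using cell assms(2) by (intro integral_localize) (auto simp: ramp_def)
  also have "integral {b..T} (\<lambda>s. ramp Q s * r s) = integral {b..T} (\<lambda>s. poly Q b * r s)"
    using cell by (intro integral_cong) (auto simp: ramp_def)
  finally show ?thesis by simp
qed

text \<open>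
  Moving the matrix to the other factor is what produces the transpose, hence the matrix \<open>B\<close> of the
  reversed problem.
\<close>

lemma ip_mat_vec_component:
  "ip (ncomp P) (mat_vec (ncomp P) A (\<lambda>k. if k = i then c else 0)) y
    = c * mat_vec (ncomp P) (\<lambda>k l. A l k) y i"
  using i by (simp add: ip_def mat_vec_def if_distrib sum_distrib_left mult_ac cong: if_cong)

lemma ip_component: "ip (ncomp P) (\<lambda>k. if k = i then c else 0) y = c * y i"
  using i by (simp add: ip_def if_distrib if_distribR cong: if_cong)

end

section \<open>The local bound for the four methods\<close>

text \<open>
  The subtracted quantity is the primitive \<open>F\<^sub>i\<close> at the left end of the interval and not the value of
  the polynomial there: of the four methods, only mcG makes the two agree in general.
\<close>

definition local_bound ::
  "partition \<Rightarrow> real \<Rightarrow> (nat \<Rightarrow> nat \<Rightarrow> real poly) \<Rightarrow> (nat \<Rightarrow> real) \<Rightarrow> (nat \<Rightarrow> real \<Rightarrow> real) \<Rightarrow> bool" where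
  "local_bound P D f w0 r \<longleftrightarrow>
     (\<forall>i<ncomp P. \<forall>j\<in>{1..npieces P i}. \<forall>t\<in>{node P i (j - 1)..node P i j}.
        \<bar>poly (f i j) t - (w0 i - integral {0..node P i (j - 1)} (r i))\<bar>
          \<le> D * integral {node P i (j - 1)..node P i j} (\<lambda>s. \<bar>r i s\<bar>))"

definition dual_local_bound ::
  "partition \<Rightarrow> real \<Rightarrow> (nat \<Rightarrow> nat \<Rightarrow> real poly) \<Rightarrow> (nat \<Rightarrow> real) \<Rightarrow> (nat \<Rightarrow> real \<Rightarrow> real) \<Rightarrow> bool" where
  "dual_local_bound P D f \<psi> r \<longleftrightarrow>
     (\<forall>i<ncomp P. \<forall>j\<in>{1..npieces P i}. \<forall>t\<in>{node P i (j - 1)..node P i j}.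
        \<bar>poly (f i j) t - (\<psi> i - integral {node P i j..horizon P} (r i))\<bar>
          \<le> D * integral {node P i (j - 1)..node P i j} (\<lambda>s. \<bar>r i s\<bar>))"

lemma degree_shifted_pderiv:
  fixes f :: "real poly"
  assumes "degree f \<le> d"
  shows "degree ([:- c, 1:] * pderiv f) \<le> d"
proof (cases "pderiv f = 0")
  case False
  then have "degree f \<noteq> 0" by (simp add: pderiv_eq_0_iff)
  moreover have "degree ([:- c, 1:] * pderiv f) \<le> 1 + degree (pderiv f)"
    by (rule order_trans[OF degree_mult_le]) simp
  ultimately show ?thesis using assms by (simp add: degree_pderiv)
qed simp

text \<open>
  The test function 1 gives \<open>W = F\<close> at all nodes, by continuity of \<open>W\<close> and induction; the test function
  \<open>W'\<close> then bounds the variation inside an interval.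
\<close>

lemma mcG_local_bound:
  assumes P: "valid_partition P" and q: "\<And>i j. i < ncomp P \<Longrightarrow> j \<in> {1..npieces P i} \<Longrightarrow> qdeg P i j \<le> q"
    and B: "bounded_measurable_matrix (ncomp P) (horizon P) B"
    and sol: "mcG_solution P B w0 W"
  obtains f where "left_pieces P f W"
    "local_bound P (inverse_const q + 1) f w0 (\<lambda>i s. mat_vec (ncomp P) (B s) (W s) i)"
proof -
  have W: "W \<in> broken_space P (qdeg P)" and cont: "\<And>i. i < ncomp P \<Longrightarrow> continuous_on {0..horizon P} (\<lambda>s. W s i)"
    and init: "\<And>i. i < ncomp P \<Longrightarrow> W 0 i = w0 i"
    using sol by (auto simp: mcG_solution_def mcG_V_def)
  obtain f where f: "left_pieces P f W"
    and deg: "\<And>i j. i < ncomp P \<Longrightarrow> j \<in> {1..npieces P i} \<Longrightarrow> degree (f i j) \<le> qdeg P i j"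
    using broken_space_left_pieces[OF P W] by blast
  define r where "r i s = mat_vec (ncomp P) (B s) (W s) i" for i s
  have "\<bar>poly (f i j) t - (w0 i - integral {0..node P i (j - 1)} (r i))\<bar>
      \<le> (inverse_const q + 1) * integral {node P i (j - 1)..node P i j} (\<lambda>s. \<bar>r i s\<bar>)"
    if i: "i < ncomp P" and j: "j \<in> {1..npieces P i}" and t: "t \<in> {node P i (j - 1)..node P i j}" for i j t
  proof -
    note gr = valid_partition_grid[OF P i]
    note cell = valid_partition_cell[OF P i]
    have rbm: "bounded_measurable_on 0 (horizon P) (r i)"
      unfolding r_def by (intro mat_vec_bounded_measurable B left_pieces_bounded_measurable[OF P f] i)
    have eq: "integral {node P i (l - 1)..node P i l} (\<lambda>s. poly p s * poly (pderiv (f i l)) s)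
        = - integral {node P i (l - 1)..node P i l} (\<lambda>s. poly p s * r i s)"
      if l: "l \<in> {1..npieces P i}" and p: "degree p \<le> qdeg P i l - 1" for l p
    proof -
      interpret partition_cell P i l by unfold_locales (fact P i l)+
      have "test p \<in> mcG_Vhat P"
        unfolding mcG_Vhat_def by (rule test_in_broken_space) (rule p)
      then have "integral {0..T} (\<lambda>s. ip (ncomp P) (dt W s) (test p s))
          = - integral {0..T} (\<lambda>s. ip (ncomp P) (mat_vec (ncomp P) (B s) (W s)) (test p s))"
        using sol by (simp add: mcG_solution_def)
      then have "integral {a..b} (\<lambda>s. poly p s * dt W s i) = - integral {a..b} (\<lambda>s. poly p s * r i s)"
        unfolding integral_ip_test r_def .
      moreover have "integral {a..b} (\<lambda>s. poly p s * dt W s i) = integral {a..b} (\<lambda>s. poly p s * poly (pderiv (f i l)) s)"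
        using f i l deriv_eq_poly_pderiv[of a b "\<lambda>s. W s i" "f i l"]
        by (intro integral_localize) (auto simp: dt_def left_pieces_def)
      ultimately show ?thesis by simp
    qed
    have start: "poly (f i l) (node P i (l - 1)) = W (node P i (l - 1)) i" if l: "l \<in> {1..npieces P i}" for l
    proof -
      have "continuous_on {node P i (l - 1)..node P i l} (\<lambda>s. W s i)"
        using cell[OF l] by (intro continuous_on_subset[OF cont[OF i]]) auto
      then have "((\<lambda>s. W s i) \<longlongrightarrow> W (node P i (l - 1)) i) (at_right (node P i (l - 1)))"
        by (rule continuous_on_Icc_at_rightD) (rule cell(2)[OF l])
      moreover have "((\<lambda>s. W s i) \<longlongrightarrow> poly (f i l) (node P i (l - 1))) (at_right (node P i (l - 1)))"
        using f i l by (intro tendsto_at_right_poly[OF cell(2)[OF l]]) (auto simp: left_pieces_def)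
      ultimately show ?thesis using tendsto_unique by (metis trivial_limit_at_right_real)
    qed
    have "W (node P i l) i = W (node P i 0) i - integral {node P i 0..node P i l} (r i)"
      if "l \<le> npieces P i" for l
    proof (rule grid_accumulate[OF gr(1) _ that])
      show "r i integrable_on {node P i 0..node P i (npieces P i)}"
        using bounded_measurable_on_integrable(1)[OF rbm] gr by simp
      fix l assume l: "l \<in> {1..npieces P i}"
      have "W (node P i l) i = poly (f i l) (node P i l)"
        using f i l cell(2)[OF l] by (auto simp: left_pieces_def)
      moreover have "poly (f i l) (node P i l) - poly (f i l) (node P i (l - 1))
          = - integral {node P i (l - 1)..node P i l} (r i)"
        using eq[OF l, of 1] integral_pderiv[of "node P i (l - 1)" "node P i l" "f i l"] cell(2)[OF l] by simp
      ultimately show "W (node P i l) i = W (node P i (l - 1)) i - integral {node P i (l - 1)..node P i l} (r i)"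
        using start[OF l] by simp
    qed
    from this[of "j - 1"] have "poly (f i j) (node P i (j - 1)) = w0 i - integral {0..node P i (j - 1)} (r i)"
      using start[OF j] gr init[OF i] j by auto
    moreover have rb: "bounded_measurable_on (node P i (j - 1)) (node P i j) (r i)"
      using cell[OF j] by (intro bounded_measurable_on_subinterval[OF rbm]) auto
    moreover have "\<bar>poly (f i j) t - poly (f i j) (node P i (j - 1))\<bar>
        \<le> inverse_const q * integral {node P i (j - 1)..node P i j} (\<lambda>s. \<bar>r i s\<bar>)"
    proof (rule continuous_method_local_bound[OF cell(2)[OF j] _ rb _ t])
      show "degree (f i j) \<le> q" using deg[OF i j] q[OF i j] by simp
      show "integral {node P i (j - 1)..node P i j} (\<lambda>s. poly (pderiv (f i j)) s * poly (pderiv (f i j)) s)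
          = - integral {node P i (j - 1)..node P i j} (\<lambda>s. poly (pderiv (f i j)) s * r i s)"
        using deg[OF i j] by (intro eq[OF j]) (simp add: degree_pderiv)
    qed
    moreover have "0 \<le> integral {node P i (j - 1)..node P i j} (\<lambda>s. \<bar>r i s\<bar>)"
      by (intro integral_nonneg bounded_measurable_on_integrable rb) auto
    ultimately show ?thesis by (simp add: distrib_right)
  qed
  then show thesis using f by (intro that[of f]) (auto simp: local_bound_def r_def[abs_def])
qed

text \<open>
  Here the test function 1 gives \<open>W(b\<^sup>-) = F(b)\<close> at the right ends of the intervals, the incoming value
  \<open>W(a\<^sup>-)\<close> being \<open>w0\<close> or the end value of the previous piece.
\<close>

lemma mdG_local_bound:
  assumes P: "valid_partition P" and q: "\<And>i j. i < ncomp P \<Longrightarrow> j \<in> {1..npieces P i} \<Longrightarrow> qdeg P i j \<le> q"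
    and B: "bounded_measurable_matrix (ncomp P) (horizon P) B"
    and sol: "mdG_solution P B w0 W"
  obtains f where "left_pieces P f W"
    "local_bound P (inverse_const q + 1) f w0 (\<lambda>i s. mat_vec (ncomp P) (B s) (W s) i)"
proof -
  have W: "W \<in> broken_space P (qdeg P)"
    and init: "\<And>i. i < ncomp P \<Longrightarrow> ((\<lambda>s. W s i) \<longlongrightarrow> w0 i) (at_left 0)"
    using sol by (auto simp: mdG_solution_def mdG_V_def)
  obtain f where f: "left_pieces P f W"
    and deg: "\<And>i j. i < ncomp P \<Longrightarrow> j \<in> {1..npieces P i} \<Longrightarrow> degree (f i j) \<le> qdeg P i j"
    using broken_space_left_pieces[OF P W] by blast
  define r where "r i s = mat_vec (ncomp P) (B s) (W s) i" for i s
  have "\<bar>poly (f i j) t - (w0 i - integral {0..node P i (j - 1)} (r i))\<bar>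
      \<le> (inverse_const q + 1) * integral {node P i (j - 1)..node P i j} (\<lambda>s. \<bar>r i s\<bar>)"
    if i: "i < ncomp P" and j: "j \<in> {1..npieces P i}" and t: "t \<in> {node P i (j - 1)..node P i j}" for i j t
  proof -
    note gr = valid_partition_grid[OF P i]
    note cell = valid_partition_cell[OF P i]
    have rbm: "bounded_measurable_on 0 (horizon P) (r i)"
      unfolding r_def by (intro mat_vec_bounded_measurable B left_pieces_bounded_measurable[OF P f] i)
    \<comment> \<open>the value with which the solution arrives at node l\<close>
    define v where "v l = (if l = 0 then w0 i else poly (f i l) (node P i l))" for l
    have jump: "jump (\<lambda>s. W s i) (node P i (l - 1)) = poly (f i l) (node P i (l - 1)) - v (l - 1)"
      if l: "l \<in> {1..npieces P i}" for l
    proof -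
      have "right_lim (\<lambda>s. W s i) (node P i (l - 1)) = poly (f i l) (node P i (l - 1))"
        using f i l by (intro right_lim_eq tendsto_at_right_poly[OF cell(2)[OF l]]) (auto simp: left_pieces_def)
      moreover have "left_lim (\<lambda>s. W s i) (node P i (l - 1)) = v (l - 1)"
      proof (cases "l = 1")
        case True
        then show ?thesis using left_lim_eq[OF init[OF i]] gr by (simp add: v_def)
      next
        case False
        then have l': "l - 1 \<in> {1..npieces P i}" using l by auto
        have "left_lim (\<lambda>s. W s i) (node P i (l - 1)) = poly (f i (l - 1)) (node P i (l - 1))"
          using f i l' by (intro left_lim_eq tendsto_at_left_poly[OF cell(2)[OF l']]) (auto simp: left_pieces_def)
        moreover have "l - 1 \<noteq> 0" using l' by auto
        ultimately show ?thesis by (simp add: v_def)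
      qed
      ultimately show ?thesis by (simp add: jump_def)
    qed
    have eq: "(poly (f i l) (node P i (l - 1)) - v (l - 1)) * poly p (node P i (l - 1))
        + integral {node P i (l - 1)..node P i l} (\<lambda>s. poly (pderiv (f i l)) s * poly p s)
        = - integral {node P i (l - 1)..node P i l} (\<lambda>s. poly p s * r i s)"
      if l: "l \<in> {1..npieces P i}" and p: "degree p \<le> qdeg P i l" for l p
    proof -
      interpret partition_cell P i l by unfold_locales (fact P i l)+
      have "test p \<in> mdG_V P"
        unfolding mdG_V_def by (rule test_in_broken_space) (rule p)
      then have "mdG_form P W (test p)
          = - integral {0..T} (\<lambda>s. ip (ncomp P) (mat_vec (ncomp P) (B s) (W s)) (test p s))"
        using sol by (simp add: mdG_solution_def)
      then show ?thesis
        unfolding integral_ip_test mdG_form_test_right[OF f] jump[OF l] r_def .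
    qed
    have acc: "v l = v 0 - integral {node P i 0..node P i l} (r i)"
      if "l \<le> npieces P i" for l
    proof (rule grid_accumulate[OF gr(1) _ that])
      show "r i integrable_on {node P i 0..node P i (npieces P i)}"
        using bounded_measurable_on_integrable(1)[OF rbm] gr by simp
      fix l assume l: "l \<in> {1..npieces P i}"
      show "v l = v (l - 1) - integral {node P i (l - 1)..node P i l} (r i)"
        using eq[OF l, of 1] integral_pderiv[of "node P i (l - 1)" "node P i l" "f i l"] cell(2)[OF l] l
        by (auto simp: v_def)
    qed
    let ?S = "integral {node P i (j - 1)..node P i j} (\<lambda>s. \<bar>r i s\<bar>)"
    have rb: "bounded_measurable_on (node P i (j - 1)) (node P i j) (r i)"
      using cell[OF j] by (intro bounded_measurable_on_subinterval[OF rbm]) auto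
    have "\<bar>poly (f i j) t - poly (f i j) (node P i j)\<bar> \<le> inverse_const q * ?S"
    proof (rule discontinuous_method_local_bound[OF cell(2)[OF j] _ rb, of _ _ "node P i (j - 1)"])
      show "degree (f i j) \<le> q" using deg[OF i j] q[OF i j] by simp
      show "\<bar>integral {node P i (j - 1)..node P i j}
          (\<lambda>s. (s - node P i (j - 1)) * poly (pderiv (f i j)) s * poly (pderiv (f i j)) s)\<bar>
          = \<bar>integral {node P i (j - 1)..node P i j} (\<lambda>s. (s - node P i (j - 1)) * poly (pderiv (f i j)) s * r i s)\<bar>"
        using eq[OF j degree_shifted_pderiv[OF deg[OF i j]], of "node P i (j - 1)"]
        by (simp add: algebra_simps)
    qed (use t in auto)
    moreover have "poly (f i j) (node P i j) = v (j - 1) - integral {node P i (j - 1)..node P i j} (r i)"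
      using eq[OF j, of 1] integral_pderiv[of "node P i (j - 1)" "node P i j" "f i j"] cell(2)[OF j] by simp
    moreover have "v (j - 1) = w0 i - integral {0..node P i (j - 1)} (r i)"
      using acc[of "j - 1"] gr j by (auto simp: v_def)
    moreover have "\<bar>integral {node P i (j - 1)..node P i j} (r i)\<bar> \<le> ?S"
      by (rule abs_integral_le[OF rb])
    ultimately show ?thesis unfolding distrib_right by linarith
  qed
  then show thesis using f by (intro that[of f]) (auto simp: local_bound_def r_def[abs_def])
qed

text \<open>
  Integration by parts moves the derivative from the test function to \<open>\<Phi>\<close> and turns the equation
  into the mdG equation run backwards: the jump now sits at the right end \<open>b\<close>, with incoming value
  \<open>\<Phi>(b\<^sup>+)\<close>, and the test function \<open>(s - b) \<Phi>'\<close> vanishes there.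
\<close>

lemma mdG_dual_local_bound:
  assumes P: "valid_partition P" and q: "\<And>i j. i < ncomp P \<Longrightarrow> j \<in> {1..npieces P i} \<Longrightarrow> qdeg P i j \<le> q"
    and A: "bounded_measurable_matrix (ncomp P) (horizon P) (\<lambda>s k l. A s l k)"
    and sol: "mdG_dual_solution P A \<psi> \<Phi>"
  obtains f where "left_pieces P f \<Phi>"
    "dual_local_bound P (inverse_const q + 1) f \<psi> (\<lambda>i s. mat_vec (ncomp P) (\<lambda>k l. A s l k) (\<Phi> s) i)"
proof -
  have "\<Phi> \<in> broken_space P (qdeg P)"
    using sol by (auto simp: mdG_dual_solution_def mdG_V_def)
  then obtain f where f: "left_pieces P f \<Phi>"
    and deg: "\<And>i j. i < ncomp P \<Longrightarrow> j \<in> {1..npieces P i} \<Longrightarrow> degree (f i j) \<le> qdeg P i j"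
    using broken_space_left_pieces[OF P] by blast
  define r where "r i s = mat_vec (ncomp P) (\<lambda>k l. A s l k) (\<Phi> s) i" for i s
  have "\<bar>poly (f i j) t - (\<psi> i - integral {node P i j..horizon P} (r i))\<bar>
      \<le> (inverse_const q + 1) * integral {node P i (j - 1)..node P i j} (\<lambda>s. \<bar>r i s\<bar>)"
    if i: "i < ncomp P" and j: "j \<in> {1..npieces P i}" and t: "t \<in> {node P i (j - 1)..node P i j}" for i j t
  proof -
    note gr = valid_partition_grid[OF P i]
    note cell = valid_partition_cell[OF P i]
    have rbm: "bounded_measurable_on 0 (horizon P) (r i)"
      unfolding r_def by (intro mat_vec_bounded_measurable A left_pieces_bounded_measurable[OF P f] i)
    \<comment> \<open>the value with which the dual solution arrives at node l from the right\<close>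
    define v where "v l = (if l = npieces P i then \<psi> i else poly (f i (Suc l)) (node P i l))" for l
    have eq: "poly p (node P i l) * (poly (f i l) (node P i l) - v l)
        - integral {node P i (l - 1)..node P i l} (\<lambda>s. poly p s * poly (pderiv (f i l)) s)
        = - integral {node P i (l - 1)..node P i l} (\<lambda>s. poly p s * r i s)"
      if l: "l \<in> {1..npieces P i}" and p: "degree p \<le> qdeg P i l" for l p
    proof -
      interpret partition_cell P i l by unfold_locales (fact P i l)+
      have zero: "((\<lambda>s. test p s k) \<longlongrightarrow> 0) (at_left 0)" for k
        using bump_left_limit[of 1 p] gr l by (cases "k = i") (auto simp: test_def)
      have "test p \<in> mdG_V P"
        unfolding mdG_V_def by (rule test_in_broken_space) (rule p)
      then have "mdG_form P (test p) \<Phi>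
          = - integral {0..T} (\<lambda>s. ip (ncomp P) (mat_vec (ncomp P) (A s) (test p s)) (\<Phi> s))
            + ip (ncomp P) (test p T) \<psi>"
        using sol zero by (simp add: mdG_dual_solution_def)
      moreover have "integral {0..T} (\<lambda>s. ip (ncomp P) (mat_vec (ncomp P) (A s) (test p s)) (\<Phi> s))
          = integral {a..b} (\<lambda>s. poly p s * r i s)"
      proof (rule integral_localize)
        have e: "ip (ncomp P) (mat_vec (ncomp P) (A s) (test p s)) (\<Phi> s) = bump p s * r i s" for s
          unfolding test_def[abs_def] ip_mat_vec_component r_def ..
        show "{a..b} \<subseteq> {0..T}" using cell by auto
        show "ip (ncomp P) (mat_vec (ncomp P) (A s) (test p s)) (\<Phi> s) = poly p s * r i s"
          if "s \<in> {a<..<b}" for s using that by (simp add: e bump_inside)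
        show "ip (ncomp P) (mat_vec (ncomp P) (A s) (test p s)) (\<Phi> s) = 0"
          if "s \<in> {0..T} - {a..b}" for s using bump_outside[OF that] by (simp add: e)
      qed
      moreover have "ip (ncomp P) (test p T) \<psi> = (if l = npieces P i then poly p b * \<psi> i else 0)"
      proof -
        have "T \<in> {node P i (npieces P i - 1)<..node P i (npieces P i)}"
          using valid_partition_cell(2)[OF P i, of "npieces P i"] gr by auto
        then have "bump p T = poly (if npieces P i = l then p else 0) T"
          using gr by (intro bump_piece) auto
        then show ?thesis using gr unfolding test_def[abs_def] ip_component by auto
      qed
      ultimately have "poly p a * poly (f i l) a + integral {a..b} (\<lambda>s. poly (pderiv p) s * poly (f i l) s)
          = poly p b * v l - integral {a..b} (\<lambda>s. poly p s * r i s)"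
        unfolding mdG_form_test_left[OF f] v_def by (auto split: if_splits)
      then show ?thesis
        using integral_by_parts_poly[of a b p "f i l"] cell(2) by (simp add: algebra_simps)
    qed
    have start: "v (l - 1) = poly (f i l) (node P i (l - 1))" if "l \<in> {1..npieces P i}" for l
      using that by (auto simp: v_def)
    have one: "v (l - 1) = v l - integral {node P i (l - 1)..node P i l} (r i)"
      if l: "l \<in> {1..npieces P i}" for l
      using start[OF l] eq[OF l, of 1] integral_pderiv[of "node P i (l - 1)" "node P i l" "f i l"] cell(2)[OF l]
      by simp
    have acc: "v l = v (npieces P i) - integral {node P i l..node P i (npieces P i)} (r i)"
      if "l \<le> npieces P i" for l
      using bounded_measurable_on_integrable(1)[OF rbm] gr
      by (intro grid_accumulate_backwards[OF gr(1) _ that one]) auto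
    let ?S = "integral {node P i (j - 1)..node P i j} (\<lambda>s. \<bar>r i s\<bar>)"
    have rb: "bounded_measurable_on (node P i (j - 1)) (node P i j) (r i)"
      using cell[OF j] by (intro bounded_measurable_on_subinterval[OF rbm]) auto
    have "\<bar>poly (f i j) t - poly (f i j) (node P i (j - 1))\<bar> \<le> inverse_const q * ?S"
    proof (rule discontinuous_method_local_bound[OF cell(2)[OF j] _ rb, of _ _ "node P i j"])
      show "degree (f i j) \<le> q" using deg[OF i j] q[OF i j] by simp
      show "\<bar>integral {node P i (j - 1)..node P i j}
          (\<lambda>s. (s - node P i j) * poly (pderiv (f i j)) s * poly (pderiv (f i j)) s)\<bar>
          = \<bar>integral {node P i (j - 1)..node P i j} (\<lambda>s. (s - node P i j) * poly (pderiv (f i j)) s * r i s)\<bar>"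
        using eq[OF j degree_shifted_pderiv[OF deg[OF i j]], of "node P i j"]
        by (simp add: algebra_simps)
    qed (use t in auto)
    moreover have "poly (f i j) (node P i (j - 1)) = v j - integral {node P i (j - 1)..node P i j} (r i)"
      using one[OF j] start[OF j] by simp
    moreover have "v j = \<psi> i - integral {node P i j..horizon P} (r i)"
      using acc[of j] gr j by (auto simp: v_def)
    moreover have "\<bar>integral {node P i (j - 1)..node P i j} (r i)\<bar> \<le> ?S"
      by (rule abs_integral_le[OF rb])
    ultimately show ?thesis unfolding distrib_right by linarith
  qed
  then show thesis using f by (intro that[of f]) (auto simp: dual_local_bound_def r_def[abs_def])
qed

text \<open>
  The constant part of the test function to the right of the interval collects
  \<open>\<psi> - \<integral>\<^sub>b\<^sup>T r\<close>, so each interval is treated without induction over the intervals. The order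
  condition \<open>1 \<le> q\<^sub>i\<^sub>j\<close> ensures that an antiderivative of a function of degree \<open>q\<^sub>i\<^sub>j - 1\<close> is an
  admissible test function.
\<close>

lemma mcG_dual_local_bound:
  assumes P: "valid_partition P" and q: "\<And>i j. i < ncomp P \<Longrightarrow> j \<in> {1..npieces P i} \<Longrightarrow> qdeg P i j \<le> q"
    and A: "bounded_measurable_matrix (ncomp P) (horizon P) (\<lambda>s k l. A s l k)"
    and sol: "mcG_dual_solution P A \<psi> \<Phi>"
  obtains f where "left_pieces P f \<Phi>"
    "dual_local_bound P (inverse_const q + 1) f \<psi> (\<lambda>i s. mat_vec (ncomp P) (\<lambda>k l. A s l k) (\<Phi> s) i)"
proof -
  have "\<Phi> \<in> broken_space P (\<lambda>i j. qdeg P i j - 1)"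
    using sol by (auto simp: mcG_dual_solution_def mcG_Vhat_def)
  then obtain f where f: "left_pieces P f \<Phi>"
    and deg: "\<And>i j. i < ncomp P \<Longrightarrow> j \<in> {1..npieces P i} \<Longrightarrow> degree (f i j) \<le> qdeg P i j - 1"
    using broken_space_left_pieces[OF P] by blast
  define r where "r i s = mat_vec (ncomp P) (\<lambda>k l. A s l k) (\<Phi> s) i" for i s
  have "\<bar>poly (f i j) t - (\<psi> i - integral {node P i j..horizon P} (r i))\<bar>
      \<le> (inverse_const q + 1) * integral {node P i (j - 1)..node P i j} (\<lambda>s. \<bar>r i s\<bar>)"
    if i: "i < ncomp P" and j: "j \<in> {1..npieces P i}" and t: "t \<in> {node P i (j - 1)..node P i j}" for i j t
  proof -
    interpret partition_cell P i j by unfold_locales (fact P i j)+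
    have rbm: "bounded_measurable_on 0 T (r i)"
      unfolding r_def by (intro mat_vec_bounded_measurable A left_pieces_bounded_measurable[OF P f] i)
    have rb: "bounded_measurable_on a b (r i)"
      using cell by (intro bounded_measurable_on_subinterval[OF rbm]) auto
    have "\<bar>poly (f i j) t - (\<psi> i - integral {b..T} (r i))\<bar> \<le> inverse_const q * integral {a..b} (\<lambda>s. \<bar>r i s\<bar>)"
    proof (rule dual_continuous_method_local_bound[OF cell(2) _ rb _ t])
      show "degree (f i j) \<le> q" using deg[OF i j] q[OF i j] by simp
      fix Q :: "real poly" assume Q: "poly Q a = 0" "degree Q \<le> Suc (degree (f i j))"
      have "1 \<le> qdeg P i j" using sol i j by (auto simp: mcG_dual_solution_def mcG_orders_def)
      then have "degree Q \<le> qdeg P i j" using Q(2) deg[OF i j] by linarith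
      then have V: "ramp_test Q \<in> mcG_V P" by (rule ramp_test_in_mcG_V)
      have "ramp_test Q 0 k = 0" for k
        using cell Q by (auto simp: ramp_test_def ramp_def)
      then have "integral {0..T} (\<lambda>s. ip (ncomp P) (dt (ramp_test Q) s) (\<Phi> s)) =
          - integral {0..T} (\<lambda>s. ip (ncomp P) (mat_vec (ncomp P) (A s) (ramp_test Q s)) (\<Phi> s))
          + ip (ncomp P) (ramp_test Q T) \<psi>"
        using sol V by (simp add: mcG_dual_solution_def)
      moreover have "integral {0..T} (\<lambda>s. ip (ncomp P) (mat_vec (ncomp P) (A s) (ramp_test Q s)) (\<Phi> s))
          = integral {0..T} (\<lambda>s. ramp Q s * r i s)"
        unfolding ramp_test_def[abs_def] ip_mat_vec_component r_def ..
      moreover have "ip (ncomp P) (ramp_test Q T) \<psi> = poly Q b * \<psi> i"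
        using cell unfolding ramp_test_def[abs_def] ip_component by (simp add: ramp_def)
      moreover have "integral {a..b} (\<lambda>s. poly (pderiv Q) s * \<Phi> s i)
          = integral {a..b} (\<lambda>s. poly (pderiv Q) s * poly (f i j) s)"
        using f i j by (intro integral_localize) (auto simp: left_pieces_def)
      ultimately show "integral {a..b} (\<lambda>s. poly (pderiv Q) s * poly (f i j) s)
          = poly Q b * (\<psi> i - integral {b..T} (r i)) - integral {a..b} (\<lambda>s. poly Q s * r i s)"
        unfolding integral_dt_ramp_test integral_ramp_mult[OF rbm Q(1)] by (simp add: algebra_simps)
    qed
    moreover have "0 \<le> integral {a..b} (\<lambda>s. \<bar>r i s\<bar>)"
      by (intro integral_nonneg bounded_measurable_on_integrable rb) auto
    ultimately show ?thesis by (simp add: distrib_right)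
  qed
  then show thesis using f by (intro that[of f]) (auto simp: dual_local_bound_def r_def[abs_def])
qed

section \<open>Time reversal\<close>

lemma reflect_simps:
  "ncomp (reflect P) = ncomp P" "horizon (reflect P) = horizon P" "npieces (reflect P) = npieces P"
  "node (reflect P) i j = horizon P - node P i (npieces P i - j)"
  "qdeg (reflect P) i j = qdeg P i (npieces P i + 1 - j)"
  by (simp_all add: reflect_def)

lemma valid_partition_reflect:
  assumes "valid_partition P"
  shows "valid_partition (reflect P)"
proof -
  have "node P i (npieces P i - j) < node P i (npieces P i - (j - 1))"
    if "i < ncomp P" "j \<in> {1..npieces P i}" for i j
  proof -
    have "Suc (npieces P i - j) = npieces P i - (j - 1)" using that by auto
    then show ?thesis
      using valid_partition_cell(2)[OF assms that(1), of "Suc (npieces P i - j)"] that by auto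
  qed
  then show ?thesis using assms by (auto simp: valid_partition_def reflect_simps)
qed

lemma right_pieces_of_reflect:
  assumes P: "valid_partition P" and "left_pieces (reflect P) f \<Phi>"
  shows "right_pieces P (\<lambda>i j. pcompose (f i (npieces P i + 1 - j)) [:horizon P, -1:]) (\<lambda>s. \<Phi> (horizon P - s))"
  unfolding right_pieces_def
proof (intro allI impI conjI ballI)
  fix i assume i: "i < ncomp P"
  show "\<Phi> (horizon P - horizon P) i
      = poly (pcompose (f i (npieces P i + 1 - npieces P i)) [:horizon P, -1:]) (horizon P)"
    using assms(2) i by (simp add: left_pieces_def reflect_simps poly_pcompose)
  fix j s assume j: "j \<in> {1..npieces P i}" and s: "s \<in> {node P i (j - 1)..<node P i j}"
  define l where "l = npieces P i + 1 - j"
  have l: "l \<in> {1..npieces P i}" "npieces P i - (l - 1) = j" "npieces P i - l = j - 1"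
    using j by (auto simp: l_def)
  have "horizon P - s \<in> {node (reflect P) i (l - 1)<..node (reflect P) i l}"
    using s unfolding reflect_simps l by auto
  then have "\<Phi> (horizon P - s) i = poly (f i l) (horizon P - s)"
    using assms(2) i l(1) unfolding left_pieces_def reflect_simps by blast
  then show "\<Phi> (horizon P - s) i = poly (pcompose (f i (npieces P i + 1 - j)) [:horizon P, -1:]) s"
    by (simp add: poly_pcompose l_def)
qed

lemma local_bound_of_reflect:
  assumes P: "valid_partition P" and "dual_local_bound (reflect P) D f \<psi> r"
  shows "local_bound P D (\<lambda>i j. pcompose (f i (npieces P i + 1 - j)) [:horizon P, -1:]) \<psi>
    (\<lambda>i s. r i (horizon P - s))"
  unfolding local_bound_def
proof (intro allI impI ballI)
  fix i j t assume i: "i < ncomp P" and j: "j \<in> {1..npieces P i}"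
    and t: "t \<in> {node P i (j - 1)..node P i j}"
  define l where "l = npieces P i + 1 - j"
  have l: "l \<in> {1..npieces P i}" "npieces P i - (l - 1) = j" "npieces P i - l = j - 1"
    using j by (auto simp: l_def)
  have n: "node (reflect P) i (l - 1) = horizon P - node P i j"
    "node (reflect P) i l = horizon P - node P i (j - 1)"
    unfolding reflect_simps l by simp_all
  have "horizon P - t \<in> {node (reflect P) i (l - 1)..node (reflect P) i l}"
    using t unfolding n by auto
  then have "\<bar>poly (f i l) (horizon P - t) - (\<psi> i - integral {horizon P - node P i (j - 1)..horizon P} (r i))\<bar>
      \<le> D * integral {horizon P - node P i j..horizon P - node P i (j - 1)} (\<lambda>s. \<bar>r i s\<bar>)"
    using assms(2) i l(1) unfolding dual_local_bound_def reflect_simps(1-3) n[symmetric] by blast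
  moreover have "integral {0..node P i (j - 1)} (\<lambda>s. r i (horizon P - s))
      = integral {horizon P - node P i (j - 1)..horizon P} (r i)"
    using integral_mirror[of 0 "node P i (j - 1)" "r i" "horizon P"] by simp
  moreover have "integral {node P i (j - 1)..node P i j} (\<lambda>s. \<bar>r i (horizon P - s)\<bar>)
      = integral {horizon P - node P i j..horizon P - node P i (j - 1)} (\<lambda>s. \<bar>r i s\<bar>)"
    by (rule integral_mirror)
  ultimately show "\<bar>poly (pcompose (f i (npieces P i + 1 - j)) [:horizon P, -1:]) t
        - (\<psi> i - integral {0..node P i (j - 1)} (\<lambda>s. r i (horizon P - s)))\<bar>
      \<le> D * integral {node P i (j - 1)..node P i j} (\<lambda>s. \<bar>r i (horizon P - s)\<bar>)"
    by (simp add: poly_pcompose l_def)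
qed

lemma bounded_measurable_matrix_iff:
  "bounded_measurable_matrix N T B \<longleftrightarrow> (\<forall>i<N. \<forall>j<N. bounded_measurable_on 0 T (\<lambda>s. B s i j))"
  by (simp add: bounded_measurable_matrix_def bounded_measurable_on_def)

lemma star_local_bound:
  assumes P: "valid_partition P" and q: "\<And>i j. i < ncomp P \<Longrightarrow> j \<in> {1..npieces P i} \<Longrightarrow> qdeg P i j \<le> q"
    and B: "bounded_measurable_matrix (ncomp P) (horizon P) B"
    and sol: "mcG_star_solution P B w0 W \<or> mdG_star_solution P B w0 W"
  obtains f where "right_pieces P f W"
    "local_bound P (inverse_const q + 1) f w0 (\<lambda>i s. mat_vec (ncomp P) (B s) (W s) i)"
proof -
  obtain A \<Phi> where sol': "mcG_dual_solution (reflect P) A w0 \<Phi> \<or> mdG_dual_solution (reflect P) A w0 \<Phi>"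
    and BA: "\<And>s i j. B s i j = A (horizon P - s) j i" and W: "W = (\<lambda>s. \<Phi> (horizon P - s))"
    using sol unfolding mcG_star_solution_def mdG_star_solution_def by blast
  note P' = valid_partition_reflect[OF P]
  have q': "qdeg (reflect P) i j \<le> q" if "i < ncomp (reflect P)" "j \<in> {1..npieces (reflect P) i}" for i j
    using that by (auto simp: reflect_simps intro!: q)
  have AB: "A s l k = B (horizon P - s) k l" for s k l by (simp add: BA)
  have A: "bounded_measurable_matrix (ncomp (reflect P)) (horizon (reflect P)) (\<lambda>s k l. A s l k)"
    unfolding AB reflect_simps bounded_measurable_matrix_iff
  proof (intro allI impI)
    fix k l assume "k < ncomp P" "l < ncomp P"
    with B have "bounded_measurable_on 0 (horizon P) (\<lambda>s. B s k l)"
      unfolding bounded_measurable_matrix_iff by blast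
    then show "bounded_measurable_on 0 (horizon P) (\<lambda>s. B (horizon P - s) k l)"
      by (rule bounded_measurable_on_mirror)
  qed
  let ?r = "\<lambda>i s. mat_vec (ncomp (reflect P)) (\<lambda>k l. A s l k) (\<Phi> s) i"
  obtain f where f: "left_pieces (reflect P) f \<Phi>" "dual_local_bound (reflect P) (inverse_const q + 1) f w0 ?r"
    using sol'
  proof
    assume "mcG_dual_solution (reflect P) A w0 \<Phi>"
    from mcG_dual_local_bound[OF P' q' A this] show thesis using that by blast
  next
    assume "mdG_dual_solution (reflect P) A w0 \<Phi>"
    from mdG_dual_local_bound[OF P' q' A this] show thesis using that by blast
  qed
  have "(\<lambda>i s. ?r i (horizon P - s)) = (\<lambda>i s. mat_vec (ncomp P) (B s) (W s) i)"
    by (intro ext) (simp add: reflect_simps W BA mat_vec_def)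
  then show thesis
    using that right_pieces_of_reflect[OF P f(1)] local_bound_of_reflect[OF P f(2)] by (simp add: W)
qed

section \<open>Stability over the synchronized slabs\<close>

lemma lp_norm_near:
  assumes "1 \<le> N" "1 \<le> p" "0 \<le> c" "\<And>i. i < N \<Longrightarrow> \<bar>y i - x i\<bar> \<le> c * g i"
  shows "lp_norm N p y \<le> lp_norm N p x + c * lp_norm N p g"
proof -
  have "lp_norm N p y = lp_norm N p (\<lambda>i. x i + (y i - x i))" by simp
  also have "\<dots> \<le> lp_norm N p x + lp_norm N p (\<lambda>i. y i - x i)"
    by (rule lp_norm_triangle[OF assms(1,2)])
  also have "lp_norm N p (\<lambda>i. y i - x i) \<le> lp_norm N p (\<lambda>i. c * g i)"
    using assms(4) by (intro lp_norm_mono assms(1,2)) (meson abs_ge_self order_trans)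
  also have "\<dots> \<le> c * lp_norm N p g" by (rule lp_norm_scale_le[OF assms(1-3)])
  finally show ?thesis by simp
qed

text \<open>
  The discrete Gronwall step. With \<open>Y = sup \<parallel>W\<parallel>\<close> over the open slab, \<open>\<parallel>G\<parallel> \<le> (\<beta> - \<alpha>) \<kappa> Y\<close> and
  \<open>Y \<le> \<parallel>x\<parallel> + D \<parallel>G\<parallel> \<le> \<parallel>x\<parallel> + Y / 2\<close>. The a priori bound \<open>Z\<close> makes \<open>Y\<close> finite.
\<close>

lemma slab_load_bound:
  fixes W r :: "real \<Rightarrow> nat \<Rightarrow> real"
  assumes N: "1 \<le> N" and p: "1 \<le> p" and "\<alpha> < \<beta>" "0 \<le> D" "0 \<le> \<kappa>"
    and r: "\<And>i. i < N \<Longrightarrow> bounded_measurable_on \<alpha> \<beta> (\<lambda>s. r s i)"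
    and W: "\<And>s. s \<in> {\<alpha><..<\<beta>} \<Longrightarrow> lp_norm N p (W s) \<le> Z"
    and load: "\<And>s. s \<in> {\<alpha><..<\<beta>} \<Longrightarrow> lp_norm N p (r s) \<le> \<kappa> * lp_norm N p (W s)"
    and near: "\<And>s i. s \<in> {\<alpha><..<\<beta>} \<Longrightarrow> i < N \<Longrightarrow>
      \<bar>W s i - x i\<bar> \<le> D * integral {\<alpha>..\<beta>} (\<lambda>s. \<bar>r s i\<bar>)"
    and small: "2 * D * (\<beta> - \<alpha>) * \<kappa> \<le> 1"
  shows "lp_norm N p (\<lambda>i. integral {\<alpha>..\<beta>} (\<lambda>s. \<bar>r s i\<bar>)) \<le> 2 * (\<beta> - \<alpha>) * \<kappa> * lp_norm N p x"
proof -
  define Y where "Y = (SUP s\<in>{\<alpha><..<\<beta>}. lp_norm N p (W s))"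
  have WY: "lp_norm N p (W s) \<le> Y" if "s \<in> {\<alpha><..<\<beta>}" for s
    unfolding Y_def using that W by (intro cSUP_upper bdd_aboveI2[of _ _ Z]) auto
  let ?G = "lp_norm N p (\<lambda>i. integral {\<alpha>..\<beta>} (\<lambda>s. \<bar>r s i\<bar>))"
  have G: "?G \<le> (\<beta> - \<alpha>) * (\<kappa> * Y)"
  proof (rule lp_norm_integral_le[OF N p \<open>\<alpha> < \<beta>\<close>])
    show "(\<lambda>s. \<bar>r s i\<bar>) integrable_on {\<alpha>..\<beta>}" if "i < N" for i
      by (rule bounded_measurable_on_integrable(2)[OF r[OF that]])
    fix s assume s: "s \<in> {\<alpha><..<\<beta>}"
    have "lp_norm N p (\<lambda>i. \<bar>r s i\<bar>) \<le> lp_norm N p (r s)" by (intro lp_norm_mono N p) auto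
    also have "\<dots> \<le> \<kappa> * lp_norm N p (W s)" by (rule load[OF s])
    also have "\<dots> \<le> \<kappa> * Y" using WY[OF s] \<open>0 \<le> \<kappa>\<close> by (rule mult_left_mono)
    finally show "lp_norm N p (\<lambda>i. \<bar>r s i\<bar>) \<le> \<kappa> * Y" .
  qed auto
  have Y0: "0 \<le> Y"
    using WY[of "(\<alpha> + \<beta>) / 2"] lp_norm_nonneg[OF N, of p "W ((\<alpha> + \<beta>) / 2)"] \<open>\<alpha> < \<beta>\<close> by (auto simp: field_simps)
  have "lp_norm N p (W s) \<le> lp_norm N p x + Y / 2" if s: "s \<in> {\<alpha><..<\<beta>}" for s
  proof -
    have "lp_norm N p (W s) \<le> lp_norm N p x + D * ?G"
      by (rule lp_norm_near[OF N p \<open>0 \<le> D\<close> near[OF s]])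
    also have "D * ?G \<le> D * ((\<beta> - \<alpha>) * (\<kappa> * Y))" using G \<open>0 \<le> D\<close> by (rule mult_left_mono)
    also have "\<dots> = (2 * D * (\<beta> - \<alpha>) * \<kappa>) * (Y / 2)" by simp
    also have "\<dots> \<le> 1 * (Y / 2)" using small Y0 by (intro mult_right_mono) auto
    finally show ?thesis by simp
  qed
  then have "Y \<le> lp_norm N p x + Y / 2"
    using \<open>\<alpha> < \<beta>\<close> unfolding Y_def by (intro cSUP_least) auto
  then have "Y \<le> 2 * lp_norm N p x" by simp
  then have "(\<beta> - \<alpha>) * (\<kappa> * Y) \<le> (\<beta> - \<alpha>) * (\<kappa> * (2 * lp_norm N p x))"
    using \<open>\<alpha> < \<beta>\<close> \<open>0 \<le> \<kappa>\<close> by (intro mult_left_mono) auto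
  moreover have "(\<beta> - \<alpha>) * (\<kappa> * (2 * lp_norm N p x)) = 2 * (\<beta> - \<alpha>) * \<kappa> * lp_norm N p x" by simp
  ultimately show ?thesis using G by linarith
qed

lemma lp_opnorm_le_Linf_mat:
  assumes N: "1 \<le> N" and p: "1 \<le> p" and B: "bounded_measurable_matrix N T B"
    and "{\<alpha>..\<beta>} \<subseteq> {0..T}" "s \<in> {\<alpha>..\<beta>}"
  shows "lp_opnorm N p (B s) \<le> Linf_mat N p \<alpha> \<beta> B"
proof -
  have "\<exists>K. \<forall>s\<in>{0..T}. \<bar>B s i j\<bar> \<le> K" if "i < N" "j < N" for i j
    using B that bounded_measurable_onE[of 0 T "\<lambda>s. B s i j"]
    unfolding bounded_measurable_matrix_def bounded_measurable_on_def by metis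
  then obtain K where K: "\<And>i j s. i < N \<Longrightarrow> j < N \<Longrightarrow> s \<in> {0..T} \<Longrightarrow> \<bar>B s i j\<bar> \<le> K i j" by metis
  define R where "R = (\<Sum>i<N. \<Sum>j<N. \<bar>K i j\<bar>)"
  have R0: "0 \<le> R" unfolding R_def by (intro sum_nonneg) auto
  have R: "\<bar>B s i j\<bar> \<le> R" if "i < N" "j < N" "s \<in> {0..T}" for i j s
  proof -
    have "\<bar>B s i j\<bar> \<le> \<bar>K i j\<bar>" using K[OF that] by linarith
    also have "\<dots> \<le> (\<Sum>j<N. \<bar>K i j\<bar>)" using that by (intro member_le_sum) auto
    also have "\<dots> \<le> R" unfolding R_def using that
      by (intro member_le_sum[of i "{..<N}" "\<lambda>i. \<Sum>j<N. \<bar>K i j\<bar>"]) (auto intro: sum_nonneg)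
    finally show ?thesis .
  qed
  have "bdd_above ((\<lambda>s. lp_opnorm N p (B s)) ` {\<alpha>..\<beta>})"
  proof (rule bdd_aboveI2)
    fix t assume "t \<in> {\<alpha>..\<beta>}"
    then show "lp_opnorm N p (B t) \<le> real N * R * lp_norm N p (\<lambda>_. 1)"
      using assms(4) R by (intro lp_opnorm_le N p R0) auto
  qed
  then show ?thesis unfolding Linf_mat_def using assms(5) by (intro cSUP_upper)
qed

lemma piece_within_slab:
  assumes "grid x n" "j \<in> {1..n}" "\<alpha> \<in> x ` {0..n}" "\<beta> \<in> x ` {0..n}" "\<alpha> < x j" "x (j - 1) < \<beta>"
  shows "\<alpha> \<le> x (j - 1)" "x j \<le> \<beta>"
proof -
  obtain k l where "k \<le> n" "\<alpha> = x k" "l \<le> n" "\<beta> = x l" using assms(3,4) by auto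
  then show "\<alpha> \<le> x (j - 1)" "x j \<le> \<beta>"
    using grid_piece_between_nodes[OF assms(1,2), of k] grid_piece_between_nodes[OF assms(1,2), of l] assms(5,6)
    by auto
qed

text \<open>
  The four methods enter only through the local bound and through the side from which the pieces are
  closed. A time \<open>t\<close> is called good for the slab \<open>m\<close> if all components of \<open>W t\<close> are close to \<open>F\<close> at the
  beginning of that slab; the case distinction on the side of closure decides which slab is
  responsible for a value taken at a synchronized level.
\<close>

lemma stability_from_local_bound:
  assumes P: "valid_partition P" and sync: "synchronized_levels P M \<tau>"
    and B: "bounded_measurable_matrix (ncomp P) (horizon P) B" and p: "1 \<le> p" and D: "1 \<le> D"
    and pieces: "left_pieces P f W \<or> right_pieces P f W"
    and loc: "local_bound P D f w0 (\<lambda>i s. mat_vec (ncomp P) (B s) (W s) i)"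
    and small: "\<forall>n\<in>{1..M}. (\<tau> n - \<tau> (n - 1)) * (6 * D) * Linf_mat (ncomp P) p (\<tau> (n - 1)) (\<tau> n) B \<le> 1"
    and n: "n \<in> {1..M}"
  shows "Linf_vec (ncomp P) p (\<tau> (n - 1)) (\<tau> n) W \<le> 6 * D * lp_norm (ncomp P) p w0 *
    exp (\<Sum>m=1..n - 1. (\<tau> m - \<tau> (m - 1)) * (6 * D) * Linf_mat (ncomp P) p (\<tau> (m - 1)) (\<tau> m) B)"
proof -
  define N where "N = ncomp P"
  define T where "T = horizon P"
  define r where "r s = mat_vec N (B s) (W s)" for s
  define F where "F t i = w0 i - integral {0..t} (\<lambda>s. r s i)" for t i
  define \<kappa> where "\<kappa> m = Linf_mat N p (\<tau> (m - 1)) (\<tau> m) B" for m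
  define K where "K m = \<tau> m - \<tau> (m - 1)" for m
  define G where "G m i = integral {\<tau> (m - 1)..\<tau> m} (\<lambda>s. \<bar>r s i\<bar>)" for m i
  have N: "1 \<le> N" using P by (simp add: valid_partition_def N_def)
  have \<tau>: "grid \<tau> M" "\<tau> 0 = 0" "\<tau> M = T"
    and nodes: "\<And>m i. m \<le> M \<Longrightarrow> i < N \<Longrightarrow> \<tau> m \<in> node P i ` {0..npieces P i}"
    using sync by (auto simp: synchronized_levels_def grid_def N_def T_def)
  have slab: "0 \<le> \<tau> (m - 1)" "\<tau> (m - 1) < \<tau> m" "\<tau> m \<le> T" if "m \<in> {1..M}" for m
    using that \<tau> grid_le[OF \<tau>(1), of 0 "m - 1"] grid_le[OF \<tau>(1), of m M] by (auto simp: grid_def)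
  have Wbm: "bounded_measurable_on 0 T (\<lambda>s. W s i)" if "i < N" for i
    using pieces that left_pieces_bounded_measurable[OF P] right_pieces_bounded_measurable[OF P]
    unfolding N_def T_def by blast
  have rbm: "bounded_measurable_on 0 T (\<lambda>s. r s i)" if "i < N" for i
    unfolding r_def using B Wbm that by (intro mat_vec_bounded_measurable) (simp_all add: N_def T_def)
  have rint: "(\<lambda>s. r s i) integrable_on {c..d}" "(\<lambda>s. \<bar>r s i\<bar>) integrable_on {c..d}"
    "\<bar>integral {c..d} (\<lambda>s. r s i)\<bar> \<le> integral {c..d} (\<lambda>s. \<bar>r s i\<bar>)"
    if "i < N" "0 \<le> c" "d \<le> T" for i c d
  proof -
    have "bounded_measurable_on c d (\<lambda>s. r s i)"
      using that by (intro bounded_measurable_on_subinterval[OF rbm]) auto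
    then show "(\<lambda>s. r s i) integrable_on {c..d}" "(\<lambda>s. \<bar>r s i\<bar>) integrable_on {c..d}"
      "\<bar>integral {c..d} (\<lambda>s. r s i)\<bar> \<le> integral {c..d} (\<lambda>s. \<bar>r s i\<bar>)"
      using bounded_measurable_on_integrable abs_integral_le by blast+
  qed
  have Fdiff: "F d i - F c i = - integral {c..d} (\<lambda>s. r s i)" if "i < N" "0 \<le> c" "c \<le> d" "d \<le> T" for i c d
    using Henstock_Kurzweil_Integration.integral_combine[OF that(2,3) rint(1)[OF that(1) order_refl that(4)]]
    by (simp add: F_def)
  have near_piece: "\<bar>poly (f i j) t - F (\<tau> (m - 1)) i\<bar> \<le> D * G m i"
    if m: "m \<in> {1..M}" and i: "i < N" and j: "j \<in> {1..npieces P i}"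
      and meet: "\<tau> (m - 1) < node P i j" "node P i (j - 1) < \<tau> m"
      and t: "t \<in> {node P i (j - 1)..node P i j}" for m i j t
  proof -
    define a b where "a = node P i (j - 1)" and "b = node P i j"
    have i': "i < ncomp P" using i by (simp add: N_def)
    have sub: "\<tau> (m - 1) \<le> a" "b \<le> \<tau> m" and ab: "a < b"
      using piece_within_slab[OF valid_partition_grid(1)[OF P i'] j nodes[OF _ i] nodes[OF _ i] meet]
        m valid_partition_cell(2)[OF P i' j] by (auto simp: a_def b_def)
    note s = slab[OF m]
    have "\<bar>poly (f i j) t - F a i\<bar> \<le> D * integral {a..b} (\<lambda>s. \<bar>r s i\<bar>)"
      using loc i' j t unfolding local_bound_def F_def a_def b_def r_def N_def by blast
    moreover have "\<bar>F a i - F (\<tau> (m - 1)) i\<bar> \<le> integral {\<tau> (m - 1)..a} (\<lambda>s. \<bar>r s i\<bar>)"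
      using Fdiff[OF i, of "\<tau> (m - 1)" a] rint(3)[OF i, of "\<tau> (m - 1)" a] s sub ab by simp
    moreover have "1 * integral {\<tau> (m - 1)..a} (\<lambda>s. \<bar>r s i\<bar>) \<le> D * integral {\<tau> (m - 1)..a} (\<lambda>s. \<bar>r s i\<bar>)"
      using D rint(2)[OF i, of "\<tau> (m - 1)" a] s sub ab by (intro mult_right_mono integral_nonneg) auto
    moreover have "integral {\<tau> (m - 1)..a} (\<lambda>s. \<bar>r s i\<bar>) + integral {a..b} (\<lambda>s. \<bar>r s i\<bar>)
        = integral {\<tau> (m - 1)..b} (\<lambda>s. \<bar>r s i\<bar>)"
      using s sub ab by (intro Henstock_Kurzweil_Integration.integral_combine rint(2)[OF i]) auto
    then have "D * integral {\<tau> (m - 1)..b} (\<lambda>s. \<bar>r s i\<bar>)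
        = D * integral {\<tau> (m - 1)..a} (\<lambda>s. \<bar>r s i\<bar>) + D * integral {a..b} (\<lambda>s. \<bar>r s i\<bar>)"
      by (metis distrib_left)
    moreover have "integral {\<tau> (m - 1)..b} (\<lambda>s. \<bar>r s i\<bar>) \<le> G m i"
      unfolding G_def using s sub ab by (intro integral_subset_le rint(2)[OF i]) auto
    then have "D * integral {\<tau> (m - 1)..b} (\<lambda>s. \<bar>r s i\<bar>) \<le> D * G m i"
      using D by (intro mult_left_mono) auto
    ultimately show ?thesis by linarith
  qed
  define good where "good t m \<longleftrightarrow> (\<forall>i<N. \<bar>W t i - F (\<tau> (m - 1)) i\<bar> \<le> D * G m i)" for t m
  have good_cover: "(\<forall>m\<in>{1..M}. \<forall>t\<in>{\<tau> (m - 1)<..<\<tau> m}. good t m) \<and>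
    (\<forall>t\<in>{\<tau> (n - 1)..\<tau> n}. \<exists>m\<in>{1..M}. m \<le> Suc n \<and> good t m)"
    using pieces
  proof
    assume left: "left_pieces P f W"
    have pos: "good t m" if m: "m \<in> {1..M}" and t: "\<tau> (m - 1) < t" "t \<le> \<tau> m" for t m
      unfolding good_def
    proof (intro allI impI)
      fix i assume i: "i < N"
      then have i': "i < ncomp P" by (simp add: N_def)
      obtain j where j: "j \<in> {1..npieces P i}" "node P i (j - 1) < t" "t \<le> node P i j"
        using grid_locate_left_open[of "node P i" t "npieces P i"] valid_partition_grid[OF P i'] t slab[OF m]
        by (auto simp: T_def)
      have "W t i = poly (f i j) t" using left i' j by (auto simp: left_pieces_def)
      then show "\<bar>W t i - F (\<tau> (m - 1)) i\<bar> \<le> D * G m i"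
        using near_piece[OF m i j(1), of t] j t by auto
    qed
    have zero: "good 0 1"
      unfolding good_def
    proof (intro allI impI)
      fix i assume i: "i < N"
      then have i': "i < ncomp P" by (simp add: N_def)
      note g = valid_partition_grid[OF P i'] valid_partition_cell[OF P i', of 1]
      have "W 0 i = poly (f i 1) 0" using left i' by (auto simp: left_pieces_def)
      then show "\<bar>W 0 i - F (\<tau> (1 - 1)) i\<bar> \<le> D * G 1 i"
        using near_piece[of 1 i 1 0] i g slab[of 1] n \<tau> by auto
    qed
    show ?thesis
    proof (intro conjI ballI)
      fix t assume t: "t \<in> {\<tau> (n - 1)..\<tau> n}"
      show "\<exists>m\<in>{1..M}. m \<le> Suc n \<and> good t m"
      proof (cases "t = 0")
        case True
        then show ?thesis using zero n by (intro bexI[of _ 1]) auto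
      next
        case False
        then obtain m where m: "m \<in> {1..M}" "\<tau> (m - 1) < t" "t \<le> \<tau> m"
          using grid_locate_left_open[of \<tau> t M] t slab[OF n] \<tau> by auto
        have "m \<le> Suc n"
        proof (rule ccontr)
          assume "\<not> m \<le> Suc n"
          then have "\<tau> n \<le> \<tau> (m - 1)" using m by (intro grid_le[OF \<tau>(1)]) auto
          then show False using m t by auto
        qed
        then show ?thesis using m pos by blast
      qed
    qed (use pos in auto)
  next
    assume right: "right_pieces P f W"
    have pos: "good t m" if m: "m \<in> {1..M}" and t: "\<tau> (m - 1) \<le> t" "t < \<tau> m" for t m
      unfolding good_def
    proof (intro allI impI)
      fix i assume i: "i < N"
      then have i': "i < ncomp P" by (simp add: N_def)
      obtain j where j: "j \<in> {1..npieces P i}" "node P i (j - 1) \<le> t" "t < node P i j"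
        using grid_locate_right_open[of "node P i" t "npieces P i"] valid_partition_grid[OF P i'] t slab[OF m]
        by (auto simp: T_def)
      have "W t i = poly (f i j) t" using right i' j by (auto simp: right_pieces_def)
      then show "\<bar>W t i - F (\<tau> (m - 1)) i\<bar> \<le> D * G m i"
        using near_piece[OF m i j(1), of t] j t by auto
    qed
    have final: "good T M"
      unfolding good_def
    proof (intro allI impI)
      fix i assume i: "i < N"
      then have i': "i < ncomp P" by (simp add: N_def)
      note g = valid_partition_grid[OF P i'] valid_partition_cell[OF P i', of "npieces P i"]
      have "W T i = poly (f i (npieces P i)) T" using right i' by (auto simp: right_pieces_def T_def)
      then show "\<bar>W T i - F (\<tau> (M - 1)) i\<bar> \<le> D * G M i"
        using near_piece[of M i "npieces P i" T] i g slab[of M] n \<tau> by (auto simp: T_def)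
    qed
    show ?thesis
    proof (intro conjI ballI)
      fix t assume t: "t \<in> {\<tau> (n - 1)..\<tau> n}"
      show "\<exists>m\<in>{1..M}. m \<le> Suc n \<and> good t m"
      proof (cases "t = T")
        case True
        have "n = M"
        proof (rule ccontr)
          assume "n \<noteq> M"
          then have "\<tau> n < \<tau> M" using n by (intro grid_less[OF \<tau>(1)]) auto
          then show False using True t \<tau> by auto
        qed
        then show ?thesis using True final n by (intro bexI[of _ M]) auto
      next
        case False
        then obtain m where m: "m \<in> {1..M}" "\<tau> (m - 1) \<le> t" "t < \<tau> m"
          using grid_locate_right_open[of \<tau> t M] t slab[OF n] \<tau> by auto
        have "m \<le> Suc n"
        proof (rule ccontr)
          assume "\<not> m \<le> Suc n"
          then have "\<tau> n < \<tau> (m - 1)" using m by (intro grid_less[OF \<tau>(1)]) auto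
          then show False using m t by auto
        qed
        then show ?thesis using m pos by blast
      qed
    qed (use pos in auto)
  qed
  have "\<exists>Z. \<forall>s\<in>{0..T}. \<bar>W s i\<bar> \<le> Z" if "i < N" for i
    using Wbm[OF that] by (metis bounded_measurable_onE)
  then obtain Z where Z: "\<And>i s. i < N \<Longrightarrow> s \<in> {0..T} \<Longrightarrow> \<bar>W s i\<bar> \<le> Z i" by metis
  have WZ: "lp_norm N p (W s) \<le> lp_norm N p Z" if "s \<in> {0..T}" for s
    using Z that by (intro lp_norm_mono N p) (meson abs_ge_self order_trans)
  have op: "lp_opnorm N p (B s) \<le> \<kappa> m" if "m \<in> {1..M}" "s \<in> {\<tau> (m - 1)..\<tau> m}" for m s
    unfolding \<kappa>_def using B slab[OF that(1)] that(2)
    by (intro lp_opnorm_le_Linf_mat[OF N p, of T]) (auto simp: N_def T_def)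
  have \<kappa>0: "0 \<le> \<kappa> m" if "m \<in> {1..M}" for m
    using op[OF that, of "\<tau> m"] slab[OF that] lp_opnorm_nonneg[OF N p, of "B (\<tau> m)"] by auto
  have sm: "K m * (6 * D) * \<kappa> m \<le> 1" "0 \<le> K m * \<kappa> m" if "m \<in> {1..M}" for m
    using small that slab[OF that] \<kappa>0[OF that] by (auto simp: K_def \<kappa>_def N_def)
  have Gb: "lp_norm N p (G m) \<le> 2 * K m * \<kappa> m * lp_norm N p (F (\<tau> (m - 1)))" if m: "m \<in> {1..M}" for m
    unfolding G_def[abs_def] K_def
  proof (rule slab_load_bound[OF N p slab(2)[OF m] _ \<kappa>0[OF m]])
    show "0 \<le> D" using D by simp
    show "2 * D * (\<tau> m - \<tau> (m - 1)) * \<kappa> m \<le> 1"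
    proof -
      have "2 * D * (K m * \<kappa> m) \<le> 6 * D * (K m * \<kappa> m)"
        using D sm(2)[OF m] by (intro mult_right_mono) auto
      moreover have "6 * D * (K m * \<kappa> m) = K m * (6 * D) * \<kappa> m" by simp
      moreover have "2 * D * (\<tau> m - \<tau> (m - 1)) * \<kappa> m = 2 * D * (K m * \<kappa> m)"
        by (simp only: K_def mult.assoc)
      ultimately show ?thesis using sm(1)[OF m] by linarith
    qed
    show "bounded_measurable_on (\<tau> (m - 1)) (\<tau> m) (\<lambda>s. r s i)" if "i < N" for i
      using slab[OF m] by (intro bounded_measurable_on_subinterval[OF rbm[OF that]]) auto
    fix s assume s: "s \<in> {\<tau> (m - 1)<..<\<tau> m}"
    show "lp_norm N p (W s) \<le> lp_norm N p Z" using slab[OF m] s by (intro WZ) auto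
    have "lp_norm N p (r s) \<le> lp_opnorm N p (B s) * lp_norm N p (W s)"
      unfolding r_def by (rule lp_norm_mat_vec_le[OF N p])
    also have "\<dots> \<le> \<kappa> m * lp_norm N p (W s)"
      using s by (intro mult_right_mono op m lp_norm_nonneg N) auto
    finally show "lp_norm N p (r s) \<le> \<kappa> m * lp_norm N p (W s)" .
    show "\<bar>W s i - F (\<tau> (m - 1)) i\<bar> \<le> D * integral {\<tau> (m - 1)..\<tau> m} (\<lambda>s. \<bar>r s i\<bar>)" if "i < N" for i
      using good_cover m s that unfolding good_def G_def by blast
  qed
  have F_growth: "lp_norm N p (F (\<tau> l)) \<le> lp_norm N p w0 * exp (\<Sum>m=1..l. K m * (6 * D) * \<kappa> m)"
    if "l \<le> M" for l
    using that
  proof (induction l)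
    case 0
    have "F (\<tau> 0) = w0" by (auto simp: F_def \<tau>)
    then show ?case by simp
  next
    case (Suc l)
    then have m: "Suc l \<in> {1..M}" by auto
    let ?x = "K (Suc l) * (6 * D) * \<kappa> (Suc l)"
    note nn = lp_norm_nonneg[OF N, of p]
    have "lp_norm N p (F (\<tau> (Suc l))) \<le> lp_norm N p (F (\<tau> l)) + 1 * lp_norm N p (G (Suc l))"
    proof (rule lp_norm_near[OF N p])
      fix i assume i: "i < N"
      show "\<bar>F (\<tau> (Suc l)) i - F (\<tau> l) i\<bar> \<le> 1 * G (Suc l) i"
        using Fdiff[OF i, of "\<tau> l" "\<tau> (Suc l)"] rint(3)[OF i, of "\<tau> l" "\<tau> (Suc l)"] slab[OF m]
        by (simp add: G_def)
    qed simp
    also have "\<dots> \<le> (1 + 2 * (K (Suc l) * \<kappa> (Suc l))) * lp_norm N p (F (\<tau> l))"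
      using Gb[OF m] by (simp add: algebra_simps)
    also have "\<dots> \<le> exp ?x * lp_norm N p (F (\<tau> l))"
    proof (intro mult_right_mono nn)
      have "2 * (K (Suc l) * \<kappa> (Suc l)) \<le> 6 * D * (K (Suc l) * \<kappa> (Suc l))"
        using D sm(2)[OF m] by (intro mult_right_mono) auto
      also have "\<dots> = ?x" by simp
      finally show "1 + 2 * (K (Suc l) * \<kappa> (Suc l)) \<le> exp ?x"
        using exp_ge_add_one_self[of ?x] by linarith
    qed
    also have "\<dots> \<le> exp ?x * (lp_norm N p w0 * exp (\<Sum>m=1..l. K m * (6 * D) * \<kappa> m))"
      using Suc by (intro mult_left_mono) auto
    also have "\<dots> = lp_norm N p w0 * exp (\<Sum>m=1..Suc l. K m * (6 * D) * \<kappa> m)"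
      by (simp add: exp_add)
    finally show ?case .
  qed
  let ?E = "\<lambda>l. \<Sum>m=1..l. K m * (6 * D) * \<kappa> m"
  have "lp_norm N p (W t) \<le> 6 * D * lp_norm N p w0 * exp (?E (n - 1))" if t: "t \<in> {\<tau> (n - 1)..\<tau> n}" for t
  proof -
    note nn = lp_norm_nonneg[OF N, of p]
    obtain m where m: "m \<in> {1..M}" "m \<le> Suc n" "good t m" using good_cover t by blast
    have "lp_norm N p (W t) \<le> lp_norm N p (F (\<tau> (m - 1))) + D * lp_norm N p (G m)"
      using m(3) D by (intro lp_norm_near N p) (auto simp: good_def)
    also have "D * lp_norm N p (G m) \<le> D * (2 * K m * \<kappa> m * lp_norm N p (F (\<tau> (m - 1))))"
      using Gb[OF m(1)] D by (intro mult_left_mono) auto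
    also have "\<dots> = (K m * (6 * D) * \<kappa> m / 3) * lp_norm N p (F (\<tau> (m - 1)))" by simp
    also have "\<dots> \<le> 1 * lp_norm N p (F (\<tau> (m - 1)))"
    proof (intro mult_right_mono nn)
      have "x / 3 \<le> 1" if "x \<le> 1" for x :: real using that by simp
      then show "K m * (6 * D) * \<kappa> m / 3 \<le> 1" using sm(1)[OF m(1)] by blast
    qed
    finally have "lp_norm N p (W t) \<le> 2 * lp_norm N p (F (\<tau> (m - 1)))" by simp
    also have "\<dots> \<le> 2 * (lp_norm N p w0 * exp (?E (m - 1)))"
      using m by (intro mult_left_mono F_growth) auto
    also have "\<dots> \<le> 2 * (lp_norm N p w0 * (3 * exp (?E (n - 1))))"
    proof -
      have "?E (m - 1) \<le> ?E n"
        using m n D sm(2) by (intro sum_mono2) (auto simp: mult.assoc mult.left_commute[of _ D])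
      also have "?E n = ?E (n - 1) + K n * (6 * D) * \<kappa> n"
        using n by (cases n) auto
      \<comment> \<open>the worst case m = n + 1 costs the exponent of one further slab\<close>
      also have "\<dots> \<le> ?E (n - 1) + 1" using sm(1)[OF n] by simp
      finally have "exp (?E (m - 1)) \<le> exp (?E (n - 1)) * exp 1" by (simp add: exp_add[symmetric])
      also have "\<dots> \<le> exp (?E (n - 1)) * 3" using exp_le by (intro mult_left_mono) auto
      finally show ?thesis using nn by (intro mult_left_mono) auto
    qed
    also have "\<dots> = 6 * 1 * (lp_norm N p w0 * exp (?E (n - 1)))" by simp
    also have "\<dots> \<le> 6 * D * (lp_norm N p w0 * exp (?E (n - 1)))"
      using D nn by (intro mult_right_mono mult_left_mono) auto
    finally show ?thesis by (simp add: mult.assoc)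
  qed
  then have "Linf_vec N p (\<tau> (n - 1)) (\<tau> n) W \<le> 6 * D * lp_norm N p w0 * exp (?E (n - 1))"
    unfolding Linf_vec_def using slab[OF n] by (intro cSUP_least) auto
  then show ?thesis unfolding K_def \<kappa>_def N_def .
qed

lemma qdeg_le_max_order:
  assumes "i < ncomp P" "j \<in> {1..npieces P i}"
  shows "qdeg P i j \<le> max_order P"
  unfolding max_order_def
proof (rule Max_ge)
  show "qdeg P i j \<in> (\<Union>i<ncomp P. qdeg P i ` {1..npieces P i})" using assms by blast
qed simp

theorem theorem4p2:
  fixes q :: nat
  shows "\<exists>C>0. \<forall>(P :: partition) (B :: real \<Rightarrow> nat \<Rightarrow> nat \<Rightarrow> real) (w0 :: nat \<Rightarrow> real)
      (W :: real \<Rightarrow> nat \<Rightarrow> real) (M :: nat) (\<tau> :: nat \<Rightarrow> real) (p :: ereal).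
    valid_partition P \<longrightarrow> max_order P = q \<longrightarrow> synchronized_levels P M \<tau> \<longrightarrow>
    bounded_measurable_matrix (ncomp P) (horizon P) B \<longrightarrow>
    mcG_solution P B w0 W \<or> mdG_solution P B w0 W \<or>
      mcG_star_solution P B w0 W \<or> mdG_star_solution P B w0 W \<longrightarrow>
    1 \<le> p \<longrightarrow>
    (\<forall>n\<in>{1..M}. (\<tau> n - \<tau> (n - 1)) * C * Linf_mat (ncomp P) p (\<tau> (n - 1)) (\<tau> n) B \<le> 1) \<longrightarrow>
    (\<forall>n\<in>{1..M}. Linf_vec (ncomp P) p (\<tau> (n - 1)) (\<tau> n) W
       \<le> C * lp_norm (ncomp P) p w0 *
         exp (\<Sum>m=1..n - 1. (\<tau> m - \<tau> (m - 1)) * C *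
                Linf_mat (ncomp P) p (\<tau> (m - 1)) (\<tau> m) B))"
proof -
  define D where "D = inverse_const q + 1"
  have D: "1 \<le> D" using inverse_const_ge_1[of q] by (simp add: D_def)
  show ?thesis
  proof (intro exI[of _ "6 * D"] conjI allI impI ballI)
    show "6 * D > 0" using D by simp
    fix P B w0 W M \<tau> p n
    assume P: "valid_partition P" and q: "max_order P = q" and sync: "synchronized_levels P M \<tau>"
      and B: "bounded_measurable_matrix (ncomp P) (horizon P) B"
      and sol: "mcG_solution P B w0 W \<or> mdG_solution P B w0 W \<or>
        mcG_star_solution P B w0 W \<or> mdG_star_solution P B w0 W"
      and p: "1 \<le> (p :: ereal)"
      and small: "\<forall>n\<in>{1..M}. (\<tau> n - \<tau> (n - 1)) * (6 * D) * Linf_mat (ncomp P) p (\<tau> (n - 1)) (\<tau> n) B \<le> 1"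
      and n: "n \<in> {1..M}"
    have deg: "qdeg P i j \<le> q" if "i < ncomp P" "j \<in> {1..npieces P i}" for i j
      using qdeg_le_max_order[OF that] q by simp
    obtain f where "left_pieces P f W \<or> right_pieces P f W"
      "local_bound P D f w0 (\<lambda>i s. mat_vec (ncomp P) (B s) (W s) i)"
      using sol unfolding D_def
    proof (elim disjE)
      assume "mcG_solution P B w0 W"
      from mcG_local_bound[OF P deg B this] show thesis using that unfolding D_def by blast
    next
      assume "mdG_solution P B w0 W"
      from mdG_local_bound[OF P deg B this] show thesis using that unfolding D_def by blast
    next
      assume "mcG_star_solution P B w0 W"
      from star_local_bound[OF P deg B disjI1[OF this]] show thesis using that unfolding D_def by blast
    next
      assume "mdG_star_solution P B w0 W"
      from star_local_bound[OF P deg B disjI2[OF this]] show thesis using that unfolding D_def by blast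
    qed
    then show "Linf_vec (ncomp P) p (\<tau> (n - 1)) (\<tau> n) W
       \<le> 6 * D * lp_norm (ncomp P) p w0 *
         exp (\<Sum>m=1..n - 1. (\<tau> m - \<tau> (m - 1)) * (6 * D) *
                Linf_mat (ncomp P) p (\<tau> (m - 1)) (\<tau> m) B)"
      by (intro stability_from_local_bound[OF P sync B p D _ _ small n])
  qed
qed

end
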